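(* The mapping $\overline{\varphi}:(G\times L)/\alpha(L)\to\mathbb{T}=(G\times H)/\tilde L$ defines a completion of $(G\times L)/\alpha(L)$. In particular, $\mathbb{T}$ may be regarded as the Hausdorff completion of $G$ with respect to the mixed topology.
   Context: Setting. $G$ is a $\sigma$-compact locally compact Abelian (Hausdorff) group, written additively, with Haar measure $\theta$. $\mathcal{A}=\{A_n\}$ is a fixed sequence of relatively compact open subsets with $A_1\neq\varnothing$, $\overline{A_n}\subset A_{n+1}$, $\bigcup_nA_n=G$. $S\subset G$ is countable, $w:S\to\mathbb{C}$, and $\omega=\sum_{x\in S}w(x)\delta_x$ is a complex regular Borel measure on $G$. Put $\Delta=S-S$ and $\eta_n(z)=\frac{1}{\theta(A_n)}\sum_{x,y\in S\cap A_n,\ x-y=z}w(x)\overline{w(y)}$ for $z\in\Delta$, $\eta_n(z)=0$ otherwise. Standing assumptions: (1) $\omega$ is translation bounded, i.e. $\sup_{t\in G}\sum_{x\in S\cap(t+K)}|w(x)|<\infty$ for every compact $K\subset G$. (2) $\eta(z)=\lim_n\eta_n(z)$ exists for all $z\in\Delta$ (so $\eta(z)=0$ for $z\notin\Delta$), and $\eta(0)>0$. (3) $\Delta$ is closed and discrete in $G$. (4) For every $\varepsilon>0$ the set $P_\varepsilon$ defined below is relatively dense in $G$ (there is a compact $K$ with $P_\varepsilon+K=G$). Notation: $\Delta^{\rm ess}=\{z\in G\mid\eta(z)\neq0\}$; $L$ is the subgroup of $G$ generated by $\Delta^{\rm ess}$; $\varrho(s,t)=|1-\eta(s-t)/\eta(0)|^{1/2}$,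 a translation invariant pseudo-metric on $G$ and $L$; the topology it defines on $L$ is the AC topology; $P_\varepsilon=\{t\in G\mid\varrho(t,0)<\varepsilon\}$. $H$ is the Hausdorff completion of $L$ in the AC topology, with canonical uniformly continuous homomorphism $\varphi:L\to H$. $\tilde L=\{(t,\varphi(t))\mid t\in L\}\subset G\times H$, and $\mathbb{T}=(G\times H)/\tilde L$, a compact group. $G\times L$ carries the product of the given topology of $G$ and the AC topology of $L$; $\alpha:L\to G\times L$, $\alpha(t)=(t,t)$; $(G\times L)/\alpha(L)$ has the quotient topology. $\overline\varphi$ is the unique continuous homomorphism induced by ${\rm id}\times\varphi$, i.e. $(x,t)\bmod\alpha(L)\mapsto(x,\varphi(t))\bmod\tilde L$. Via the isomorphism $G\simeq(G\times L)/\alpha(L)$, $x\mapsto(x,0)\bmod\alpha(L)$, $G$ obtains a new topology, the mixed topology. A homomorphism $\psi:A\to B$ from an Abelian topological group $A$ to a complete Hausdorff Abelian topological group $B$ "defines a completion" of $A$ if it is (uniformly) continuous, $\psi(A)$ is dense in $B$, $\psi$ is an open mapping from $A$ onto $\psi(A)$ (with the topology induced from $B$), and $\ker\psi$ is the closure of $\{0\}$ in $A$; this characterizes the Hausdorff completion up to isomorphism. *)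

theory Defs
  imports
    "HOL-Analysis.Analysis"
    "HOL-Algebra.Coset"
    "HOL-Algebra.Generated_Groups"
begin

section \<open>Abelian topological groups and completions\<close>

text \<open>The base group \<open>G\<close> is a type, but its subgroup \<open>L\<close>, the completion \<open>H\<close> and the quotients
  are not, and several of them carry topologies other than that of an ambient type. A topological
  group is therefore a pair of a group record and a topology on its carrier.\<close>

definition additive_group :: "'a::ab_group_add set \<Rightarrow> 'a monoid" where
  "additive_group A = \<lparr>carrier = A, monoid.mult = (+), one = 0\<rparr>"

definition topological_comm_group :: "('g, 'm) monoid_scheme \<Rightarrow> 'g topology \<Rightarrow> bool" where
  "topological_comm_group G X \<longleftrightarrow>
     comm_group G \<and> topspace X = carrier G \<and>
     continuous_map (prod_topology X X) X (\<lambda>(x, y). x \<otimes>\<^bsub>G\<^esub> y) \<and>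
     continuous_map X X (\<lambda>x. inv\<^bsub>G\<^esub> x)"

text \<open>Cauchy filters and completeness refer to the canonical uniformity of the group, whose
  entourages are generated by the sets \<open>{(x, y). x - y \<in> U}\<close>, \<open>U\<close> an open neighbourhood of
  the neutral element.\<close>

definition group_cauchy_filter :: "('g, 'm) monoid_scheme \<Rightarrow> 'g topology \<Rightarrow> 'g filter \<Rightarrow> bool" where
  "group_cauchy_filter G X F \<longleftrightarrow>
     (\<forall>U. openin X U \<and> \<one>\<^bsub>G\<^esub> \<in> U \<longrightarrow> (\<forall>\<^sub>F (x, y) in F \<times>\<^sub>F F. x \<otimes>\<^bsub>G\<^esub> inv\<^bsub>G\<^esub> y \<in> U))"

definition group_complete :: "('g, 'm) monoid_scheme \<Rightarrow> 'g topology \<Rightarrow> bool" where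
  "group_complete G X \<longleftrightarrow>
     (\<forall>F. F \<le> principal (carrier G) \<and> F \<noteq> bot \<and> group_cauchy_filter G X F \<longrightarrow>
          (\<exists>l. limitin X (\<lambda>x. x) l F))"

text \<open>A homomorphism of topological groups is uniformly continuous as soon as it is continuous, so
  only continuity is demanded.\<close>

definition defines_completion ::
  "('g, 'm) monoid_scheme \<Rightarrow> 'g topology \<Rightarrow> ('h, 'n) monoid_scheme \<Rightarrow> 'h topology \<Rightarrow>
     ('g \<Rightarrow> 'h) \<Rightarrow> bool" where
  "defines_completion A X B Y \<psi> \<longleftrightarrow>
     topological_comm_group A X \<and>
     topological_comm_group B Y \<and> Hausdorff_space Y \<and> group_complete B Y \<and>
     \<psi> \<in> hom A B \<and>
     continuous_map X Y \<psi> \<and>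
     Y closure_of (\<psi> ` carrier A) = carrier B \<and>
     open_map X (subtopology Y (\<psi> ` carrier A)) \<psi> \<and>
     kernel A B \<psi> = X closure_of {\<one>\<^bsub>A\<^esub>}"

section \<open>Pseudo-metric and quotient topologies\<close>

definition pseudometric_topology :: "'a set \<Rightarrow> ('a \<Rightarrow> 'a \<Rightarrow> real) \<Rightarrow> 'a topology" where
  "pseudometric_topology M d =
     topology (\<lambda>U. U \<subseteq> M \<and> (\<forall>x\<in>U. \<exists>r>0. \<forall>y\<in>M. d x y < r \<longrightarrow> y \<in> U))"

lemma openin_pseudometric_topology:
  "openin (pseudometric_topology M d) U \<longleftrightarrow>
     U \<subseteq> M \<and> (\<forall>x\<in>U. \<exists>r>0. \<forall>y\<in>M. d x y < r \<longrightarrow> y \<in> U)"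
proof -
  have "istopology (\<lambda>U. U \<subseteq> M \<and> (\<forall>x\<in>U. \<exists>r>0. \<forall>y\<in>M. d x y < r \<longrightarrow> y \<in> U))"
    unfolding istopology_def
  proof (intro conjI allI impI ballI)
    fix S T x
    assume S: "S \<subseteq> M \<and> (\<forall>x\<in>S. \<exists>r>0. \<forall>y\<in>M. d x y < r \<longrightarrow> y \<in> S)"
      and T: "T \<subseteq> M \<and> (\<forall>x\<in>T. \<exists>r>0. \<forall>y\<in>M. d x y < r \<longrightarrow> y \<in> T)"
      and x: "x \<in> S \<inter> T"
    from S x obtain r where r: "r > 0" "\<forall>y\<in>M. d x y < r \<longrightarrow> y \<in> S" by blast
    from T x obtain s where s: "s > 0" "\<forall>y\<in>M. d x y < s \<longrightarrow> y \<in> T" by blast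
    show "\<exists>r>0. \<forall>y\<in>M. d x y < r \<longrightarrow> y \<in> S \<inter> T"
      by (rule exI[of _ "min r s"]) (use r s in auto)
  next
    fix S T
    assume "S \<subseteq> M \<and> (\<forall>x\<in>S. \<exists>r>0. \<forall>y\<in>M. d x y < r \<longrightarrow> y \<in> S)"
    then show "S \<inter> T \<subseteq> M" by blast
  next
    fix \<K>
    assume "\<forall>K\<in>\<K>. K \<subseteq> M \<and> (\<forall>x\<in>K. \<exists>r>0. \<forall>y\<in>M. d x y < r \<longrightarrow> y \<in> K)"
    then show "\<Union>\<K> \<subseteq> M" by blast
  next
    fix \<K> x
    assume *: "\<forall>K\<in>\<K>. K \<subseteq> M \<and> (\<forall>x\<in>K. \<exists>r>0. \<forall>y\<in>M. d x y < r \<longrightarrow> y \<in> K)"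
      and "x \<in> \<Union>\<K>"
    then obtain K where K: "K \<in> \<K>" "x \<in> K" by blast
    with * obtain r where "r > 0" "\<forall>y\<in>M. d x y < r \<longrightarrow> y \<in> K" by blast
    with K show "\<exists>r>0. \<forall>y\<in>M. d x y < r \<longrightarrow> y \<in> \<Union>\<K>" by blast
  qed
  then show ?thesis
    by (simp add: pseudometric_topology_def topology_inverse')
qed

definition quotient_topology :: "'a topology \<Rightarrow> ('a \<Rightarrow> 'b) \<Rightarrow> 'b topology" where
  "quotient_topology X p =
     topology (\<lambda>U. U \<subseteq> p ` topspace X \<and> openin X {x \<in> topspace X. p x \<in> U})"

lemma openin_quotient_topology:
  "openin (quotient_topology X p) U \<longleftrightarrow>
     U \<subseteq> p ` topspace X \<and> openin X {x \<in> topspace X. p x \<in> U}"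
proof -
  have "istopology (\<lambda>U. U \<subseteq> p ` topspace X \<and> openin X {x \<in> topspace X. p x \<in> U})"
    unfolding istopology_def
  proof (intro conjI allI impI)
    fix S T
    assume "S \<subseteq> p ` topspace X \<and> openin X {x \<in> topspace X. p x \<in> S}"
      and "T \<subseteq> p ` topspace X \<and> openin X {x \<in> topspace X. p x \<in> T}"
    then have "openin X ({x \<in> topspace X. p x \<in> S} \<inter> {x \<in> topspace X. p x \<in> T})"
      by blast
    also have "{x \<in> topspace X. p x \<in> S} \<inter> {x \<in> topspace X. p x \<in> T} =
        {x \<in> topspace X. p x \<in> S \<inter> T}" by blast
    finally show "openin X {x \<in> topspace X. p x \<in> S \<inter> T}" .
  next
    fix \<K>
    assume "\<forall>K\<in>\<K>. K \<subseteq> p ` topspace X \<and> openin X {x \<in> topspace X. p x \<in> K}"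
    then have "openin X (\<Union>K\<in>\<K>. {x \<in> topspace X. p x \<in> K})" by blast
    also have "(\<Union>K\<in>\<K>. {x \<in> topspace X. p x \<in> K}) = {x \<in> topspace X. p x \<in> \<Union>\<K>}" by blast
    finally show "openin X {x \<in> topspace X. p x \<in> \<Union>\<K>}" .
  qed blast+
  then show ?thesis
    by (simp add: quotient_topology_def topology_inverse')
qed

lemma quotient_map_quotient_topology: "quotient_map X (quotient_topology X p) p"
proof -
  have "openin (quotient_topology X p) (p ` topspace X)"
  proof -
    have "{x \<in> topspace X. p x \<in> p ` topspace X} = topspace X" by auto
    then show ?thesis by (simp add: openin_quotient_topology)
  qed
  then have "topspace (quotient_topology X p) = p ` topspace X"
    by (metis openin_quotient_topology openin_subset openin_topspace subset_antisym)
  then show ?thesis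
    by (auto simp: quotient_map_def openin_quotient_topology)
qed

definition quotient_group_topology ::
  "('g, 'm) monoid_scheme \<Rightarrow> 'g set \<Rightarrow> 'g topology \<Rightarrow> 'g set topology" where
  "quotient_group_topology G N X = quotient_topology X (\<lambda>x. N #>\<^bsub>G\<^esub> x)"

section \<open>Haar measure\<close>

definition haar_measure :: "'a::{topological_ab_group_add, t2_space} measure \<Rightarrow> bool" where
  "haar_measure M \<longleftrightarrow>
     sets M = sets borel \<and>
     emeasure M UNIV \<noteq> 0 \<and>
     (\<forall>t. \<forall>B\<in>sets borel. emeasure M ((+) t ` B) = emeasure M B) \<and>
     (\<forall>K. compact K \<longrightarrow> emeasure M K < \<infinity>) \<and>
     (\<forall>B\<in>sets borel. emeasure M B = (INF U\<in>{U. open U \<and> B \<subseteq> U}. emeasure M U)) \<and>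
     (\<forall>U. open U \<longrightarrow> emeasure M U = (SUP K\<in>{K. compact K \<and> K \<subseteq> U}. emeasure M K))"

section \<open>Weighted Dirac combs\<close>

text \<open>For countable \<open>S\<close>, the comb \<open>\<Sum>\<^sub>x w(x) \<delta>\<^sub>x\<close> is a (not necessarily bounded) complex regular Borel
  measure when its total variation \<open>\<Sum>\<^sub>x \<bar>w(x)\<bar> \<delta>\<^sub>x\<close> is finite on compact sets. The sums below
  are taken in \<open>[0, \<infinity>]\<close>, so they always exist.\<close>

definition comb_measure :: "'a::topological_space set \<Rightarrow> ('a \<Rightarrow> complex) \<Rightarrow> bool" where
  "comb_measure S w \<longleftrightarrow>
     countable S \<and> (\<forall>K. compact K \<longrightarrow> (\<Sum>\<^sub>\<infinity>x\<in>S \<inter> K. ennreal (cmod (w x))) < \<infinity>)"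

definition translation_bounded ::
  "'a::{ab_group_add, topological_space} set \<Rightarrow> ('a \<Rightarrow> complex) \<Rightarrow> bool" where
  "translation_bounded S w \<longleftrightarrow>
     (\<forall>K. compact K \<longrightarrow> (SUP t. \<Sum>\<^sub>\<infinity>x\<in>S \<inter> (+) t ` K. ennreal (cmod (w x))) < \<infinity>)"

section \<open>Autocorrelation\<close>

definition difference_set :: "'a::ab_group_add set \<Rightarrow> 'a set" where
  "difference_set S = {x - y | x y. x \<in> S \<and> y \<in> S}"

definition autocorr_approx ::
  "'a::{topological_ab_group_add, t2_space} measure \<Rightarrow> (nat \<Rightarrow> 'a set) \<Rightarrow> 'a set \<Rightarrow> ('a \<Rightarrow> complex) \<Rightarrow>
     nat \<Rightarrow> 'a \<Rightarrow> complex" where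
  "autocorr_approx \<theta> A S w n z =
     (if z \<in> difference_set S
      then 1 / complex_of_real (measure \<theta> (A n)) *
           (\<Sum>\<^sub>\<infinity>(x, y)\<in>{(x, y). x \<in> S \<inter> A n \<and> y \<in> S \<inter> A n \<and> x - y = z}. w x * cnj (w y))
      else 0)"

definition ac_ess :: "('a \<Rightarrow> complex) \<Rightarrow> 'a set" where
  "ac_ess \<eta> = {z. \<eta> z \<noteq> 0}"

definition ac_L :: "('a::ab_group_add \<Rightarrow> complex) \<Rightarrow> 'a set" where
  "ac_L \<eta> = generate (additive_group UNIV) (ac_ess \<eta>)"

definition ac_dist :: "('a::ab_group_add \<Rightarrow> complex) \<Rightarrow> 'a \<Rightarrow> 'a \<Rightarrow> real" where
  "ac_dist \<eta> s t = sqrt (cmod (1 - \<eta> (s - t) / \<eta> 0))"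

definition ac_P :: "('a::ab_group_add \<Rightarrow> complex) \<Rightarrow> real \<Rightarrow> 'a set" where
  "ac_P \<eta> \<epsilon> = {t. ac_dist \<eta> t 0 < \<epsilon>}"

definition ac_topology :: "('a::ab_group_add \<Rightarrow> complex) \<Rightarrow> 'a topology" where
  "ac_topology \<eta> = pseudometric_topology (ac_L \<eta>) (ac_dist \<eta>)"

definition relatively_dense :: "'a::{ab_group_add, topological_space} set \<Rightarrow> bool" where
  "relatively_dense P \<longleftrightarrow> (\<exists>K. compact K \<and> {p + k | p k. p \<in> P \<and> k \<in> K} = UNIV)"

section \<open>The two quotients and the induced map\<close>

definition GL_group :: "('a::ab_group_add \<Rightarrow> complex) \<Rightarrow> ('a \<times> 'a) monoid" where
  "GL_group \<eta> = additive_group UNIV \<times>\<times> additive_group (ac_L \<eta>)"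

definition GL_topology ::
  "('a::{topological_ab_group_add, t2_space} \<Rightarrow> complex) \<Rightarrow> ('a \<times> 'a) topology" where
  "GL_topology \<eta> = prod_topology euclidean (ac_topology \<eta>)"

definition alpha_L :: "('a::ab_group_add \<Rightarrow> complex) \<Rightarrow> ('a \<times> 'a) set" where
  "alpha_L \<eta> = (\<lambda>t. (t, t)) ` ac_L \<eta>"

definition GL_quotient :: "('a::ab_group_add \<Rightarrow> complex) \<Rightarrow> ('a \<times> 'a) set monoid" where
  "GL_quotient \<eta> = GL_group \<eta> Mod alpha_L \<eta>"

definition GL_quotient_topology ::
  "('a::{topological_ab_group_add, t2_space} \<Rightarrow> complex) \<Rightarrow> ('a \<times> 'a) set topology" where
  "GL_quotient_topology \<eta> = quotient_group_topology (GL_group \<eta>) (alpha_L \<eta>) (GL_topology \<eta>)"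

definition GH_group :: "('h, 'm) monoid_scheme \<Rightarrow> ('a::ab_group_add \<times> 'h) monoid" where
  "GH_group H = additive_group UNIV \<times>\<times> H"

definition L_tilde :: "('a::ab_group_add \<Rightarrow> complex) \<Rightarrow> ('a \<Rightarrow> 'h) \<Rightarrow> ('a \<times> 'h) set" where
  "L_tilde \<eta> \<phi> = (\<lambda>t. (t, \<phi> t)) ` ac_L \<eta>"

definition torus_group ::
  "('a::ab_group_add \<Rightarrow> complex) \<Rightarrow> ('h, 'm) monoid_scheme \<Rightarrow> ('a \<Rightarrow> 'h) \<Rightarrow> ('a \<times> 'h) set monoid" where
  "torus_group \<eta> H \<phi> = GH_group H Mod L_tilde \<eta> \<phi>"

definition torus_topology ::
  "('a::{topological_ab_group_add, t2_space} \<Rightarrow> complex) \<Rightarrow> ('h, 'm) monoid_scheme \<Rightarrow> 'h topology \<Rightarrow>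
     ('a \<Rightarrow> 'h) \<Rightarrow> ('a \<times> 'h) set topology" where
  "torus_topology \<eta> H Y \<phi> =
     quotient_group_topology (GH_group H) (L_tilde \<eta> \<phi>) (prod_topology euclidean Y)"

text \<open>The induced map sends a coset to the common value of \<open>(x, t) \<mapsto> (x, \<phi> t) mod L_tilde\<close>
  on its elements; see \<open>phi_bar_coset\<close> below.\<close>

definition phi_bar ::
  "('a::ab_group_add \<Rightarrow> complex) \<Rightarrow> ('h, 'm) monoid_scheme \<Rightarrow> ('a \<Rightarrow> 'h) \<Rightarrow>
     ('a \<times> 'a) set \<Rightarrow> ('a \<times> 'h) set" where
  "phi_bar \<eta> H \<phi> C = the_elem ((\<lambda>(x, t). L_tilde \<eta> \<phi> #>\<^bsub>GH_group H\<^esub> (x, \<phi> t)) ` C)"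

definition iota :: "('a::ab_group_add \<Rightarrow> complex) \<Rightarrow> 'a \<Rightarrow> ('a \<times> 'a) set" where
  "iota \<eta> x = alpha_L \<eta> #>\<^bsub>GL_group \<eta>\<^esub> (x, 0)"

definition mixed_topology ::
  "('a::{topological_ab_group_add, t2_space} \<Rightarrow> complex) \<Rightarrow> 'a topology" where
  "mixed_topology \<eta> = pullback_topology UNIV (iota \<eta>) (GL_quotient_topology \<eta>)"

subsection \<open>Well-definedness\<close>

lemma additive_group_simps [simp]:
  "carrier (additive_group A) = A"
  "x \<otimes>\<^bsub>additive_group A\<^esub> y = x + y"
  "\<one>\<^bsub>additive_group A\<^esub> = 0"
  by (simp_all add: additive_group_def)

lemma comm_group_additive_group_UNIV: "comm_group (additive_group UNIV)"
  by (rule comm_groupI) (auto simp: add.assoc add.commute intro: exI[of _ "- _"] left_minus)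

lemma inv_additive_group_UNIV: "inv\<^bsub>additive_group UNIV\<^esub> x = - x"
proof -
  interpret comm_group "additive_group (UNIV :: 'a set)" by (rule comm_group_additive_group_UNIV)
  show ?thesis by (rule inv_equality) auto
qed

lemma ac_L_closed:
  shows "0 \<in> ac_L \<eta>" and "s \<in> ac_L \<eta> \<Longrightarrow> t \<in> ac_L \<eta> \<Longrightarrow> s + t \<in> ac_L \<eta>"
    and "t \<in> ac_L \<eta> \<Longrightarrow> - t \<in> ac_L \<eta>"
proof -
  interpret comm_group "additive_group (UNIV :: 'a set)" by (rule comm_group_additive_group_UNIV)
  have "subgroup (ac_L \<eta>) (additive_group UNIV)"
    unfolding ac_L_def by (rule generate_is_subgroup) simp
  then interpret subgroup "ac_L \<eta>" "additive_group UNIV" .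
  show "0 \<in> ac_L \<eta>" using one_closed by simp
  show "s \<in> ac_L \<eta> \<Longrightarrow> t \<in> ac_L \<eta> \<Longrightarrow> s + t \<in> ac_L \<eta>" using m_closed by simp
  show "t \<in> ac_L \<eta> \<Longrightarrow> - t \<in> ac_L \<eta>" using m_inv_closed by (simp add: inv_additive_group_UNIV)
qed

lemma comm_group_additive_group_ac_L: "comm_group (additive_group (ac_L \<eta>))"
  by (rule comm_groupI)
     (auto simp: ac_L_closed add.assoc add.commute intro!: bexI[of _ "- _"] left_minus)

lemma alpha_L_coset:
  "alpha_L \<eta> #>\<^bsub>GL_group \<eta>\<^esub> (x, t) = {(s + x, s + t) | s. s \<in> ac_L \<eta>}"
  by (auto simp: alpha_L_def r_coset_def GL_group_def)

lemma L_tilde_coset: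
  "L_tilde \<eta> \<phi> #>\<^bsub>GH_group H\<^esub> (x, h) = {(s + x, \<phi> s \<otimes>\<^bsub>H\<^esub> h) | s. s \<in> ac_L \<eta>}"
  by (auto simp: L_tilde_def r_coset_def GH_group_def)

lemma phi_bar_coset:
  fixes H (structure)
  assumes "comm_group H" and "\<phi> \<in> hom (additive_group (ac_L \<eta>)) H" and t: "t \<in> ac_L \<eta>"
  shows "phi_bar \<eta> H \<phi> (alpha_L \<eta> #>\<^bsub>GL_group \<eta>\<^esub> (x, t)) = L_tilde \<eta> \<phi> #>\<^bsub>GH_group H\<^esub> (x, \<phi> t)"
proof -
  interpret comm_group H by fact
  have clos: "\<phi> s \<in> carrier H" if "s \<in> ac_L \<eta>" for s
    using assms(2) that by (auto simp: hom_def)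
  have add: "\<phi> (s + s') = \<phi> s \<otimes> \<phi> s'" if "s \<in> ac_L \<eta>" "s' \<in> ac_L \<eta>" for s s'
    using assms(2) that by (auto simp: hom_def)
  have eq: "L_tilde \<eta> \<phi> #>\<^bsub>GH_group H\<^esub> (s + x, \<phi> (s + t)) = L_tilde \<eta> \<phi> #>\<^bsub>GH_group H\<^esub> (x, \<phi> t)"
    if s: "s \<in> ac_L \<eta>" for s
  proof -
    have "{(u + (s + x), \<phi> u \<otimes> \<phi> (s + t)) | u. u \<in> ac_L \<eta>} =
        {(u + x, \<phi> u \<otimes> \<phi> t) | u. u \<in> ac_L \<eta>}" (is "?A = ?B")
    proof (intro equalityI subsetI)
      fix p assume "p \<in> ?A"
      then obtain u where u: "u \<in> ac_L \<eta>" "p = (u + (s + x), \<phi> u \<otimes> \<phi> (s + t))" by blast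
      then have "p = ((u + s) + x, \<phi> (u + s) \<otimes> \<phi> t)"
        using s t by (simp add: add clos m_assoc add.assoc)
      then show "p \<in> ?B" using u s ac_L_closed(2) by blast
    next
      fix p assume "p \<in> ?B"
      then obtain u where u: "u \<in> ac_L \<eta>" "p = (u + x, \<phi> u \<otimes> \<phi> t)" by blast
      define v where "v = u + - s"
      have v: "v \<in> ac_L \<eta>" using u s by (simp only: v_def ac_L_closed)
      have "u = v + s" by (simp add: v_def)
      then have "p = (v + (s + x), \<phi> v \<otimes> \<phi> (s + t))"
        using u v s t by (simp add: add clos m_assoc add.assoc)
      then show "p \<in> ?A" using v by blast
    qed
    then show ?thesis by (simp add: L_tilde_coset)
  qed
  have "(\<lambda>(y, u). L_tilde \<eta> \<phi> #>\<^bsub>GH_group H\<^esub> (y, \<phi> u)) ` {(s + x, s + t) | s. s \<in> ac_L \<eta>} =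
      {L_tilde \<eta> \<phi> #>\<^bsub>GH_group H\<^esub> (x, \<phi> t)}"
    using eq ac_L_closed(1)[of \<eta>] by force
  then show ?thesis
    by (simp add: phi_bar_def alpha_L_coset)
qed

lemma iota_iso: "iota \<eta> \<in> iso (additive_group UNIV) (GL_quotient \<eta>)"
proof -
  have mult: "iota \<eta> (x + y) = iota \<eta> x <#>\<^bsub>GL_group \<eta>\<^esub> iota \<eta> y" for x y
  proof (intro equalityI subsetI)
    fix p assume "p \<in> iota \<eta> (x + y)"
    then obtain s where s: "s \<in> ac_L \<eta>" "p = (s + (x + y), s)"
      by (auto simp: iota_def alpha_L_coset)
    have "(s + x, s) \<in> iota \<eta> x" "(0 + y, 0) \<in> iota \<eta> y"
      using s ac_L_closed(1)[of \<eta>] by (force simp: iota_def alpha_L_coset)+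
    moreover have "p = (s + x, s) \<otimes>\<^bsub>GL_group \<eta>\<^esub> (0 + y, 0)"
      using s by (simp add: GL_group_def add.assoc)
    ultimately show "p \<in> iota \<eta> x <#>\<^bsub>GL_group \<eta>\<^esub> iota \<eta> y"
      unfolding set_mult_def by blast
  next
    fix p assume "p \<in> iota \<eta> x <#>\<^bsub>GL_group \<eta>\<^esub> iota \<eta> y"
    then obtain s u where "s \<in> ac_L \<eta>" "u \<in> ac_L \<eta>" "p = ((s + x) + (u + y), s + u)"
      unfolding iota_def alpha_L_coset set_mult_def by (auto simp: GL_group_def)
    then show "p \<in> iota \<eta> (x + y)"
      using ac_L_closed(2) by (auto simp: iota_def alpha_L_coset algebra_simps)
  qed
  have carr: "carrier (GL_quotient \<eta>) = (\<Union>(x, t)\<in>UNIV \<times> ac_L \<eta>. {alpha_L \<eta> #>\<^bsub>GL_group \<eta>\<^esub> (x, t)})"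
    by (auto simp: GL_quotient_def FactGroup_def RCOSETS_def GL_group_def)
  have shift: "alpha_L \<eta> #>\<^bsub>GL_group \<eta>\<^esub> (x, t) = iota \<eta> (x - t)" if t: "t \<in> ac_L \<eta>" for x t
  proof -
    have "{(s + x, s + t) | s. s \<in> ac_L \<eta>} = {(s + (x - t), s + 0) | s. s \<in> ac_L \<eta>}"
      (is "?A = ?B")
    proof (intro equalityI subsetI)
      fix p assume "p \<in> ?A"
      then obtain s where s: "s \<in> ac_L \<eta>" "p = (s + x, s + t)" by blast
      have "p = ((s + t) + (x - t), (s + t) + 0)" using s by (simp add: algebra_simps)
      then show "p \<in> ?B" using ac_L_closed(2)[OF s(1) t] by blast
    next
      fix p assume "p \<in> ?B"
      then obtain s where s: "s \<in> ac_L \<eta>" "p = (s + (x - t), s + 0)" by blast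
      have "p = ((s + - t) + x, (s + - t) + t)" using s by (simp add: algebra_simps)
      then show "p \<in> ?A" using ac_L_closed(2)[OF s(1) ac_L_closed(3)[OF t]] by blast
    qed
    then show ?thesis by (simp only: iota_def alpha_L_coset)
  qed
  have "inj (iota \<eta>)"
  proof (rule injI)
    fix x y assume "iota \<eta> x = iota \<eta> y"
    moreover have "(0 + x, 0) \<in> iota \<eta> x"
      using ac_L_closed(1)[of \<eta>] by (force simp: iota_def alpha_L_coset)
    ultimately have "(0 + x, 0) \<in> iota \<eta> y" by simp
    then show "x = y" by (auto simp: iota_def alpha_L_coset)
  qed
  moreover have "range (iota \<eta>) = carrier (GL_quotient \<eta>)"
  proof
    show "range (iota \<eta>) \<subseteq> carrier (GL_quotient \<eta>)"
      unfolding carr using ac_L_closed(1)[of \<eta>] by (force simp: iota_def)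
    show "carrier (GL_quotient \<eta>) \<subseteq> range (iota \<eta>)"
      unfolding carr using shift by auto
  qed
  ultimately show ?thesis
    using mult by (auto simp: iso_def hom_def bij_betw_def GL_quotient_def FactGroup_def)
qed

end

theory Submission
  imports Defs
begin

text \<open>Write \<open>\<pi> : G \<times> H \<rightarrow> T\<close> for the projection. The autocorrelation is a limit of positive definite
  functions, so Cauchy--Schwarz shows that \<open>\<varrho>\<close> satisfies the triangle inequality, and a
  small \<open>\<varrho>\<close>-ball in \<open>L\<close> is an open subset of \<open>\<Delta>\<close>. As \<open>\<Delta>\<close> is discrete in \<open>G\<close> and \<open>\<phi>\<close> is
  open onto its image, \<open>L_tilde\<close> is a discrete subgroup of \<open>G \<times> H\<close>. Hence \<open>T\<close> is Hausdorff, and it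
  inherits completeness from the locally compact group \<open>G\<close> and from \<open>H\<close>.

  Density, continuity and the kernel of the induced map are read off from \<open>\<phi>\<close>. For openness let
  \<open>U \<times> V\<close> be an open box in \<open>G \<times> L\<close> and \<open>\<phi>(V) = V' \<inter> \<phi>(L)\<close> with \<open>V'\<close> open in \<open>H\<close>: a point of
  \<open>\<pi>(U \<times> V')\<close> in the image of the induced map has a representative in \<open>U \<times> (V' \<inter> \<phi>(L))\<close>, so it
  is the image of a class meeting \<open>U \<times> V\<close>.\<close>

section \<open>Abelian topological groups\<close>

text \<open>As a locale over \<open>comm_group\<close>, the predicate
  \<open>topological_comm_group\<close> passes the group calculus on to quotients, products and the
  completion by interpretation.\<close>

locale topological_abelian = comm_group G for G (structure) +
  fixes X
  assumes topspace_eq [simp]: "topspace X = carrier G"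
    and continuous_mult: "continuous_map (prod_topology X X) X (\<lambda>(x, y). x \<otimes> y)"
    and continuous_inv: "continuous_map X X (\<lambda>x. inv x)"

lemma topological_abelian_iff: "topological_abelian G X \<longleftrightarrow> topological_comm_group G X"
  unfolding topological_abelian_def topological_abelian_axioms_def topological_comm_group_def by blast

text \<open>The condition on the product filter becomes the classical one: \<open>F\<close> contains
  sets that are small of order \<open>U\<close>. The later Cauchy arguments work with such
  sets.\<close>

lemma group_cauchy_filter_iff:
  "group_cauchy_filter G X F \<longleftrightarrow>
     (\<forall>U. openin X U \<and> \<one>\<^bsub>G\<^esub> \<in> U \<longrightarrow>
       (\<exists>M. (\<forall>\<^sub>F x in F. x \<in> M) \<and> (\<forall>x\<in>M. \<forall>y\<in>M. x \<otimes>\<^bsub>G\<^esub> inv\<^bsub>G\<^esub> y \<in> U)))"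
proof -
  have "(\<forall>\<^sub>F (x, y) in F \<times>\<^sub>F F. R x y) \<longleftrightarrow>
      (\<exists>M. (\<forall>\<^sub>F x in F. x \<in> M) \<and> (\<forall>x\<in>M. \<forall>y\<in>M. R x y))" for R :: "'a \<Rightarrow> 'a \<Rightarrow> bool"
    unfolding eventually_prod_same
  proof
    assume "\<exists>P. eventually P F \<and> (\<forall>x y. P x \<longrightarrow> P y \<longrightarrow> (case (x, y) of (x, y) \<Rightarrow> R x y))"
    then obtain P where "eventually P F" "\<And>x y. P x \<Longrightarrow> P y \<Longrightarrow> R x y" by auto
    then show "\<exists>M. (\<forall>\<^sub>F x in F. x \<in> M) \<and> (\<forall>x\<in>M. \<forall>y\<in>M. R x y)"
      by (intro exI[of _ "{x. P x}"]) simp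
  next
    assume "\<exists>M. (\<forall>\<^sub>F x in F. x \<in> M) \<and> (\<forall>x\<in>M. \<forall>y\<in>M. R x y)"
    then obtain M where "\<forall>\<^sub>F x in F. x \<in> M" "\<forall>x\<in>M. \<forall>y\<in>M. R x y" by blast
    then show "\<exists>P. eventually P F \<and> (\<forall>x y. P x \<longrightarrow> P y \<longrightarrow> (case (x, y) of (x, y) \<Rightarrow> R x y))"
      by (intro exI[of _ "\<lambda>x. x \<in> M"]) simp
  qed
  then show ?thesis by (simp add: group_cauchy_filter_def)
qed

lemma openin_prod_topologyE:
  assumes "openin (prod_topology X Y) U" "(x, y) \<in> U"
  obtains V W where "openin X V" "openin Y W" "x \<in> V" "y \<in> W" "V \<times> W \<subseteq> U"
  using assms openin_prod_topology_alt[of X Y U] by blast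

section \<open>Division and neighbourhoods in an abelian topological group\<close>

context topological_abelian
begin

lemma mult_div_cancel: "x \<in> carrier G \<Longrightarrow> y \<in> carrier G \<Longrightarrow> x \<otimes> (y \<otimes> inv x) = y"
  by (subst m_lcomm) auto

lemma div_translate:
  assumes "a \<in> carrier G" "b \<in> carrier G" "g \<in> carrier G"
  shows "(a \<otimes> g) \<otimes> inv (b \<otimes> g) = a \<otimes> inv b"
proof -
  have "(a \<otimes> g) \<otimes> inv (b \<otimes> g) = a \<otimes> (g \<otimes> (inv b \<otimes> inv g))"
    using assms by (simp add: inv_mult m_assoc)
  then show ?thesis using assms by (simp add: mult_div_cancel)
qed

lemma div_eq_one: "a \<in> carrier G \<Longrightarrow> b \<in> carrier G \<Longrightarrow> a \<otimes> inv b = \<one> \<Longrightarrow> a = b"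
  using inv_equality[of a "inv b"] by simp

lemma openin_carrier: "openin X U \<Longrightarrow> x \<in> U \<Longrightarrow> x \<in> carrier G"
  using openin_subset by fastforce

lemma continuous_div: "continuous_map (prod_topology X X) X (\<lambda>(x, y). x \<otimes> inv y)"
proof -
  have "continuous_map (prod_topology X X) (prod_topology X X) (\<lambda>p. (fst p, inv (snd p)))"
    by (intro continuous_map_pairedI continuous_map_fst
        continuous_map_compose[OF continuous_map_snd continuous_inv, unfolded comp_def])
  from continuous_map_compose[OF this continuous_mult]
  show ?thesis by (simp add: comp_def case_prod_unfold)
qed

lemma continuous_translate:
  assumes "a \<in> carrier G" shows "continuous_map X X (\<lambda>x. x \<otimes> a)"
proof -
  have "continuous_map X (prod_topology X X) (\<lambda>x. (x, a))"
    using assms by (intro continuous_map_pairedI) (auto simp: continuous_map_const)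
  from continuous_map_compose[OF this continuous_mult]
  show ?thesis by (simp add: comp_def)
qed

lemma openin_translate:
  assumes "openin X U" "a \<in> carrier G"
  shows "openin X {x \<in> carrier G. x \<otimes> a \<in> U}"
  using openin_continuous_map_preimage[OF continuous_translate[OF assms(2)] assms(1)] by simp

lemma div_neighbourhoods:
  assumes U: "openin X U" "x \<in> carrier G" "y \<in> carrier G" "x \<otimes> inv y \<in> U"
  obtains V W where "openin X V" "openin X W" "x \<in> V" "y \<in> W"
    "\<forall>v\<in>V. \<forall>w\<in>W. v \<otimes> inv w \<in> U"
proof -
  have "openin (prod_topology X X) {p \<in> topspace (prod_topology X X). (\<lambda>(x, y). x \<otimes> inv y) p \<in> U}"
    by (rule openin_continuous_map_preimage[OF continuous_div U(1)])
  moreover have "(x, y) \<in> {p \<in> topspace (prod_topology X X). (\<lambda>(x, y). x \<otimes> inv y) p \<in> U}"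
    using U by simp
  ultimately obtain V W where VW: "openin X V" "openin X W" "x \<in> V" "y \<in> W"
    "V \<times> W \<subseteq> {p \<in> topspace (prod_topology X X). (\<lambda>(x, y). x \<otimes> inv y) p \<in> U}"
    by (rule openin_prod_topologyE)
  from VW(5) have "\<forall>v\<in>V. \<forall>w\<in>W. v \<otimes> inv w \<in> U" by auto
  with VW(1-4) show ?thesis by (rule that)
qed

text \<open>This plays the part of halving epsilon. Intersecting the two neighbourhoods given by
  continuity of division makes one set serve on both sides, and dividing by the neutral element
  gives \<open>V \<subseteq> U\<close>.\<close>

lemma div_neighbourhood_one:
  assumes U: "openin X U" "\<one> \<in> U"
  obtains V where "openin X V" "\<one> \<in> V" "V \<subseteq> U" "\<forall>v\<in>V. \<forall>w\<in>V. v \<otimes> inv w \<in> U"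
proof -
  have one: "\<one> \<otimes> inv \<one> \<in> U" using U(2) by simp
  obtain V W where VW: "openin X V" "openin X W" "\<one> \<in> V" "\<one> \<in> W"
    "\<forall>v\<in>V. \<forall>w\<in>W. v \<otimes> inv w \<in> U"
    by (rule div_neighbourhoods[OF U(1) one_closed one_closed one])
  show ?thesis
  proof (rule that)
    show "openin X (V \<inter> W)" using VW(1,2) by (rule openin_Int)
    show "V \<inter> W \<subseteq> U"
    proof
      fix x assume "x \<in> V \<inter> W"
      then have "x \<otimes> inv \<one> \<in> U" "x \<in> carrier G" using VW(4,5) openin_carrier[OF VW(1)] by blast+
      then show "x \<in> U" by simp
    qed
    show "\<one> \<in> V \<inter> W" using VW(3,4) by (rule IntI)
    show "\<forall>v\<in>V \<inter> W. \<forall>w\<in>V \<inter> W. v \<otimes> inv w \<in> U" using VW(5) by simp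
  qed
qed

end

section \<open>Quotients by a subgroup\<close>

locale topological_abelian_quotient = topological_abelian +
  fixes N
  assumes subgroup_N: "subgroup N G"
begin

abbreviation proj where "proj x \<equiv> N #> x"
abbreviation Q where "Q \<equiv> quotient_group_topology G N X"

sublocale normal N G
  using subgroup_N by (rule subgroup_imp_normal)

sublocale quot: comm_group "G Mod N"
  by (rule abelian_FactGroup[OF subgroup_N])

sublocale proj: group_hom G "G Mod N" "\<lambda>x. N #> x"
  by unfold_locales (rule r_coset_hom_Mod)

lemma carrier_quot: "carrier (G Mod N) = proj ` carrier G"
  by (rule carrier_FactGroup)

lemma quotient_map_proj: "quotient_map X Q proj"
  unfolding quotient_group_topology_def by (rule quotient_map_quotient_topology)

lemma continuous_proj: "continuous_map X Q proj"
  by (rule quotient_imp_continuous_map[OF quotient_map_proj])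

lemma topspace_Q: "topspace Q = carrier (G Mod N)"
  using quotient_imp_surjective_map[OF quotient_map_proj] by (simp add: carrier_quot)

lemma proj_eq_one_iff: "x \<in> carrier G \<Longrightarrow> proj x = N \<longleftrightarrow> x \<in> N"
  using coset_join1 coset_join2 subgroup_N subset by blast

lemma proj_eq_iff:
  assumes "x \<in> carrier G" "y \<in> carrier G"
  shows "proj x = proj y \<longleftrightarrow> x \<otimes> inv y \<in> N"
proof -
  have "proj x = proj y \<longleftrightarrow> proj x \<otimes>\<^bsub>G Mod N\<^esub> inv\<^bsub>G Mod N\<^esub> proj y = \<one>\<^bsub>G Mod N\<^esub>"
    using assms by (metis proj.hom_closed quot.inv_solve_right' quot.l_one quot.one_closed)
  also have "\<dots> \<longleftrightarrow> proj (x \<otimes> inv y) = N"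
    using assms by (simp del: mult_FactGroup)
  also have "\<dots> \<longleftrightarrow> x \<otimes> inv y \<in> N"
    using assms by (intro proj_eq_one_iff) auto
  finally show ?thesis .
qed

text \<open>The saturation of an open set is the union of its translates by elements of
  \<open>N\<close>, each of which is open.\<close>

lemma open_map_proj: "open_map X Q proj"
proof (unfold open_map_def, intro allI impI)
  fix U assume U: "openin X U"
  have "{x \<in> carrier G. proj x \<in> proj ` U} = (\<Union>n\<in>N. {x \<in> carrier G. x \<otimes> n \<in> U})"
  proof (intro equalityI subsetI)
    fix x assume "x \<in> {x \<in> carrier G. proj x \<in> proj ` U}"
    then obtain u where u: "x \<in> carrier G" "u \<in> U" "proj u = proj x" by auto
    then have uc: "u \<in> carrier G" using U openin_carrier by blast
    then have "u \<otimes> inv x \<in> N" using u proj_eq_iff by blast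
    moreover have "x \<otimes> (u \<otimes> inv x) = u" using u uc
      by (simp add: mult_div_cancel)
    ultimately show "x \<in> (\<Union>n\<in>N. {x \<in> carrier G. x \<otimes> n \<in> U})" using u(1,2) by force
  next
    fix x assume "x \<in> (\<Union>n\<in>N. {x \<in> carrier G. x \<otimes> n \<in> U})"
    then obtain n where n: "n \<in> N" "x \<in> carrier G" "x \<otimes> n \<in> U" by blast
    then have "n \<in> carrier G" using subset by blast
    moreover have "(x \<otimes> n) \<otimes> inv x = n" using n calculation
      by (simp add: m_assoc mult_div_cancel)
    ultimately have "proj (x \<otimes> n) = proj x" using n by (subst proj_eq_iff) auto
    then show "x \<in> {x \<in> carrier G. proj x \<in> proj ` U}" using n by blast
  qed
  moreover have "openin X (\<Union>n\<in>N. {x \<in> carrier G. x \<otimes> n \<in> U})"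
    using U subset openin_translate by blast
  ultimately have "openin X {x \<in> topspace X. proj x \<in> proj ` U}" by simp
  moreover have "proj ` U \<subseteq> proj ` topspace X" using openin_subset[OF U] by blast
  ultimately show "openin Q (proj ` U)"
    unfolding quotient_group_topology_def openin_quotient_topology by simp
qed

text \<open>A product of quotient maps need not be a quotient map, but a product of continuous open
  surjections is one. This lets multiplication descend continuously to the quotient.\<close>

lemma quotient_map_proj_prod:
  "quotient_map (prod_topology X X) (prod_topology Q Q) (\<lambda>p. (proj (fst p), proj (snd p)))"
proof (rule continuous_open_imp_quotient_map)
  show "continuous_map (prod_topology X X) (prod_topology Q Q) (\<lambda>p. (proj (fst p), proj (snd p)))"
    using continuous_proj
    by (intro continuous_map_pairedI)
       (auto intro: continuous_map_compose[unfolded comp_def] continuous_map_fst continuous_map_snd)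
  show "open_map (prod_topology X X) (prod_topology Q Q) (\<lambda>p. (proj (fst p), proj (snd p)))"
  proof (unfold open_map_def, intro allI impI)
    fix U assume U: "openin (prod_topology X X) U"
    show "openin (prod_topology Q Q) ((\<lambda>p. (proj (fst p), proj (snd p))) ` U)"
      unfolding openin_prod_topology_alt
    proof (intro allI impI)
      fix c d assume "(c, d) \<in> (\<lambda>p. (proj (fst p), proj (snd p))) ` U"
      then obtain x y where xy: "(x, y) \<in> U" "c = proj x" "d = proj y" by auto
      obtain V W where VW: "openin X V" "openin X W" "x \<in> V" "y \<in> W" "V \<times> W \<subseteq> U"
        by (rule openin_prod_topologyE[OF U xy(1)])
      have "openin Q (proj ` V)" "openin Q (proj ` W)"
        using VW open_map_proj unfolding open_map_def by blast+
      moreover have "proj ` V \<times> proj ` W \<subseteq> (\<lambda>p. (proj (fst p), proj (snd p))) ` U"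
        using VW(5) by force
      ultimately show "\<exists>U' V'. openin Q U' \<and> openin Q V' \<and> c \<in> U' \<and> d \<in> V' \<and>
          U' \<times> V' \<subseteq> (\<lambda>p. (proj (fst p), proj (snd p))) ` U"
        using xy VW by blast
    qed
  qed
  show "(\<lambda>p. (proj (fst p), proj (snd p))) ` topspace (prod_topology X X) =
      topspace (prod_topology Q Q)"
    by (force simp: topspace_Q carrier_quot)
qed

sublocale quot: topological_abelian "G Mod N" Q
proof
  show "topspace Q = carrier (G Mod N)" by (rule topspace_Q)
  have "continuous_map (prod_topology X X) Q (\<lambda>p. proj ((\<lambda>(x, y). x \<otimes> y) p))"
    using continuous_map_compose[OF continuous_mult continuous_proj] by (simp add: comp_def)
  then have "continuous_map (prod_topology X X) Q
      ((\<lambda>(x, y). x \<otimes>\<^bsub>G Mod N\<^esub> y) \<circ> (\<lambda>p. (proj (fst p), proj (snd p))))"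
    by (rule continuous_map_eq) (auto simp del: mult_FactGroup)
  then show "continuous_map (prod_topology Q Q) Q (\<lambda>(x, y). x \<otimes>\<^bsub>G Mod N\<^esub> y)"
    by (rule continuous_compose_quotient_map[OF quotient_map_proj_prod])
  have "continuous_map X Q (\<lambda>x. proj (inv x))"
    using continuous_map_compose[OF continuous_inv continuous_proj] by (simp add: comp_def)
  then have "continuous_map X Q ((\<lambda>x. inv\<^bsub>G Mod N\<^esub> x) \<circ> proj)"
    by (rule continuous_map_eq) auto
  then show "continuous_map Q Q (\<lambda>x. inv\<^bsub>G Mod N\<^esub> x)"
    by (rule continuous_compose_quotient_map[OF quotient_map_proj])
qed

text \<open>Representatives of distinct cosets differ by a point of the open complement of
  \<open>N\<close>. By continuity of division this persists nearby, and the open images of the two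
  neighbourhoods separate the cosets.\<close>

lemma Hausdorff_quotient:
  assumes "closedin X N" shows "Hausdorff_space Q"
  unfolding Hausdorff_space_def
proof (intro allI impI)
  fix c d assume "c \<in> topspace Q \<and> d \<in> topspace Q \<and> c \<noteq> d"
  then obtain x y where xy: "x \<in> carrier G" "y \<in> carrier G" "c = proj x" "d = proj y"
      "proj x \<noteq> proj y"
    unfolding topspace_Q carrier_quot by auto
  have diff: "x \<otimes> inv y \<in> carrier G - N" using xy proj_eq_iff by simp
  have op: "openin X (carrier G - N)"
    using assms by (simp add: closedin_def)
  obtain V W where VW: "openin X V" "openin X W" "x \<in> V" "y \<in> W"
    "\<forall>v\<in>V. \<forall>w\<in>W. v \<otimes> inv w \<in> carrier G - N"
    by (rule div_neighbourhoods[OF op xy(1,2) diff])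
  have "proj v \<noteq> proj w" if "v \<in> V" "w \<in> W" for v w
    using VW(5) that proj_eq_iff[OF openin_carrier[OF VW(1) that(1)] openin_carrier[OF VW(2) that(2)]]
    by simp
  then have "disjnt (proj ` V) (proj ` W)" unfolding disjnt_iff by auto
  moreover have "openin Q (proj ` V)" "openin Q (proj ` W)"
    using VW open_map_proj unfolding open_map_def by blast+
  ultimately show "\<exists>U V. openin Q U \<and> openin Q V \<and> c \<in> U \<and> d \<in> V \<and> disjnt U V"
    using xy VW by blast
qed

text \<open>A sufficiently small translate around a point outside \<open>N\<close> meets
  \<open>N\<close> at most once, since two such points would differ by an element of
  \<open>O1\<close>. In a Hausdorff space that single point can be removed.\<close>

lemma discrete_imp_closedin:
  assumes "Hausdorff_space X" "openin X O1" "O1 \<inter> N = {\<one>}"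
  shows "closedin X N"
proof -
  have "openin X (carrier G - N)"
  proof (subst openin_subopen, intro ballI)
    fix x assume x: "x \<in> carrier G - N"
    obtain V where V: "openin X V" "\<one> \<in> V" "\<forall>v\<in>V. \<forall>w\<in>V. v \<otimes> inv w \<in> O1"
      by (rule div_neighbourhood_one[of O1]) (use assms in auto)
    define T where "T = {y \<in> carrier G. y \<otimes> inv x \<in> V}"
    have T: "openin X T" "x \<in> T"
      using V x openin_translate[of V "inv x"] by (auto simp: T_def)
    have eq: "n = n'" if "n \<in> N" "n' \<in> N" "n \<in> T" "n' \<in> T" for n n'
    proof -
      have c: "n \<in> carrier G" "n' \<in> carrier G" "x \<in> carrier G" using that x subset by auto
      have "(n \<otimes> inv x) \<otimes> inv (n' \<otimes> inv x) \<in> O1"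
        using V that by (auto simp: T_def)
      also have "(n \<otimes> inv x) \<otimes> inv (n' \<otimes> inv x) = n \<otimes> inv n'"
        using c by (simp add: div_translate)
      finally have "n \<otimes> inv n' \<in> O1 \<inter> N" using that by simp
      then have "n \<otimes> inv n' = \<one>" using assms by blast
      then show ?thesis using c div_eq_one by blast
    qed
    show "\<exists>T. openin X T \<and> x \<in> T \<and> T \<subseteq> carrier G - N"
    proof (cases "T \<inter> N = {}")
      case True then show ?thesis using T openin_carrier by blast
    next
      case False
      then obtain n where n: "n \<in> T" "n \<in> N" by blast
      then have "x \<noteq> n" using x by blast
      moreover have "closedin X {n}"
        using assms(1) n(2) subset by (intro closedin_Hausdorff_singleton) auto
      ultimately have "openin X (T - {n})" "x \<in> T - {n}" using T by blast+
      moreover have "T - {n} \<subseteq> carrier G - N" using eq n T openin_carrier by blast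
      ultimately show ?thesis by blast
    qed
  qed
  then show ?thesis using subset by (simp add: closedin_def)
qed

text \<open>Completeness does not pass to quotients in general. Near the neutral element, however, the
  projection along a discrete subgroup is injective, and its local inverse lifts Cauchy filters.\<close>

lemma complete_quotient:
  assumes O1: "openin X O1" "O1 \<inter> N = {\<one>}" and complete: "group_complete G X"
  shows "group_complete (G Mod N) Q"
  unfolding group_complete_def
proof (intro allI impI, elim conjE)
  fix F assume F: "F \<le> principal (carrier (G Mod N))" "F \<noteq> bot" "group_cauchy_filter (G Mod N) Q F"
  have open_image: "openin Q (proj ` U)" if "openin X U" for U
    using that open_map_proj unfolding open_map_def by blast
  have one: "\<one> \<in> O1" using O1 by blast
  \<comment> \<open>Two halvings are needed: differences of points of \<open>W\<close> lie in
    \<open>V\<close>, and differences of points of \<open>V\<close> lie in \<open>O1\<close>, where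
    only the neutral element belongs to \<open>N\<close>.\<close>
  obtain V where V: "openin X V" "\<one> \<in> V" "V \<subseteq> O1" "\<forall>v\<in>V. \<forall>w\<in>V. v \<otimes> inv w \<in> O1"
    by (rule div_neighbourhood_one[OF O1(1) one])
  obtain W where W: "openin X W" "\<one> \<in> W" "W \<subseteq> V" "\<forall>v\<in>W. \<forall>w\<in>W. v \<otimes> inv w \<in> V"
    by (rule div_neighbourhood_one[OF V(1,2)])
  have cauchy: "\<exists>M. (\<forall>\<^sub>F c in F. c \<in> M) \<and>
      (\<forall>c\<in>M. \<forall>d\<in>M. c \<in> carrier (G Mod N) \<and> (\<exists>u\<in>U. c \<otimes>\<^bsub>G Mod N\<^esub> inv\<^bsub>G Mod N\<^esub> d = proj u))"
    if U: "openin X U" "\<one> \<in> U" for U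
  proof -
    have "\<one>\<^bsub>G Mod N\<^esub> \<in> proj ` U" using U proj.hom_one by blast
    then obtain M where M: "\<forall>\<^sub>F c in F. c \<in> M"
      "\<forall>c\<in>M. \<forall>d\<in>M. c \<otimes>\<^bsub>G Mod N\<^esub> inv\<^bsub>G Mod N\<^esub> d \<in> proj ` U"
      using F(3) open_image[OF U(1)] unfolding group_cauchy_filter_iff by meson
    have "\<forall>\<^sub>F c in F. c \<in> carrier (G Mod N)" using F(1) by (simp add: le_principal)
    with M(1) have "\<forall>\<^sub>F c in F. c \<in> M \<inter> carrier (G Mod N)" by (auto elim: eventually_elim2)
    then show ?thesis using M(2) by (intro exI[of _ "M \<inter> carrier (G Mod N)"]) blast
  qed
  obtain M where M: "\<forall>\<^sub>F c in F. c \<in> M"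
    "\<And>c d. c \<in> M \<Longrightarrow> d \<in> M \<Longrightarrow> c \<in> carrier (G Mod N) \<and> (\<exists>u\<in>W. c \<otimes>\<^bsub>G Mod N\<^esub> inv\<^bsub>G Mod N\<^esub> d = proj u)"
    using cauchy[OF W(1,2)] by blast
  obtain c0 where c0: "c0 \<in> M" using M(1) F(2) by (metis eventually_happens)
  then have "c0 \<in> carrier (G Mod N)" using M(2) by blast
  then obtain g0 where g0: "g0 \<in> carrier G" "c0 = proj g0" unfolding carrier_quot by blast
  \<comment> \<open>A local section based at \<open>c0\<close>: the class \<open>c\<close> differs
    from \<open>c0\<close> by the image of a point of \<open>W\<close>, and adding the fixed
    representative \<open>g0\<close> to that point lifts \<open>c\<close>.\<close>
  define s where "s c = (SOME u. u \<in> W \<and> c = proj (u \<otimes> g0))" for c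
  have s: "s c \<in> W \<and> c = proj (s c \<otimes> g0)" if cM: "c \<in> M" for c
  proof -
    obtain u where u: "u \<in> W" "c \<otimes>\<^bsub>G Mod N\<^esub> inv\<^bsub>G Mod N\<^esub> proj g0 = proj u" "c \<in> carrier (G Mod N)"
      using M(2)[OF cM c0] g0 by blast
    then have "u \<in> carrier G" using W openin_carrier by blast
    then have "c = proj (u \<otimes> g0)" using u g0
      by (metis proj.hom_closed proj.hom_mult quot.inv_solve_right)
    with u(1) have "\<exists>u. u \<in> W \<and> c = proj (u \<otimes> g0)" by (intro exI conjI)
    then show ?thesis unfolding s_def by (rule someI_ex)
  qed
  have sW: "s c \<in> W" if "c \<in> M" for c using s[OF that] by (rule conjunct1)
  have sp: "proj (s c \<otimes> g0) = c" if "c \<in> M" for c using s[OF that] by (rule conjunct2[THEN sym])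
  have sc: "s c \<in> carrier G" if "c \<in> M" for c by (rule openin_carrier[OF W(1) sW[OF that]])
  have "group_cauchy_filter G X (filtermap s F)"
    unfolding group_cauchy_filter_iff
  proof (intro allI impI, elim conjE)
    fix U assume U: "openin X U" "\<one> \<in> U"
    then obtain M' where M': "\<forall>\<^sub>F c in F. c \<in> M'"
      "\<And>c d. c \<in> M' \<Longrightarrow> d \<in> M' \<Longrightarrow> (\<exists>u\<in>U \<inter> W. c \<otimes>\<^bsub>G Mod N\<^esub> inv\<^bsub>G Mod N\<^esub> d = proj u)"
      using cauchy[of "U \<inter> W"] W(1,2) by (metis IntI openin_Int)
    have "s c \<otimes> inv (s d) \<in> U" if "c \<in> M \<inter> M'" "d \<in> M \<inter> M'" for c d
    proof -
      obtain u where u: "u \<in> U" "u \<in> W" "c \<otimes>\<^bsub>G Mod N\<^esub> inv\<^bsub>G Mod N\<^esub> d = proj u"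
        using M' \<open>c \<in> M \<inter> M'\<close> \<open>d \<in> M \<inter> M'\<close> by blast
      have cs: "u \<in> carrier G" "s c \<in> carrier G" "s d \<in> carrier G" using u W openin_carrier sc that by auto
      have "proj u = proj (s c \<otimes> g0) \<otimes>\<^bsub>G Mod N\<^esub> inv\<^bsub>G Mod N\<^esub> proj (s d \<otimes> g0)"
        using u(3) sp that by simp
      also have "\<dots> = proj ((s c \<otimes> g0) \<otimes> inv (s d \<otimes> g0))"
        using cs g0 by (simp del: mult_FactGroup)
      also have "(s c \<otimes> g0) \<otimes> inv (s d \<otimes> g0) = s c \<otimes> inv (s d)"
        using cs g0 by (simp add: div_translate)
      finally have "proj (s c \<otimes> inv (s d)) = proj u" by (rule sym)
      \<comment> \<open>Both \<open>u\<close> and the difference of the two lifts project to the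
        same class, so they differ by an element of \<open>N\<close>. Both lie in \<open>V\<close>,
        so this element is also in \<open>O1\<close> and must be neutral.\<close>
      then have "(s c \<otimes> inv (s d)) \<otimes> inv u \<in> N"
        using cs by (subst (asm) proj_eq_iff) auto
      moreover have "s c \<otimes> inv (s d) \<in> V" "u \<in> V" using W(3,4) sW that u(2) by auto
      then have "(s c \<otimes> inv (s d)) \<otimes> inv u \<in> O1" using V(4) by auto
      ultimately have "(s c \<otimes> inv (s d)) \<otimes> inv u \<in> O1 \<inter> N" by (rule IntI[rotated])
      then have "(s c \<otimes> inv (s d)) \<otimes> inv u = \<one>" unfolding O1(2) by simp
      then have "s c \<otimes> inv (s d) = u" using cs by (auto intro: div_eq_one[OF _ cs(1)])
      then show ?thesis using u by simp
    qed
    moreover have "\<forall>\<^sub>F x in filtermap s F. x \<in> s ` (M \<inter> M')"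
      using eventually_conj[OF M(1) M'(1)] unfolding eventually_filtermap
      by (rule eventually_mono) blast
    ultimately show "\<exists>M. (\<forall>\<^sub>F x in filtermap s F. x \<in> M) \<and> (\<forall>x\<in>M. \<forall>y\<in>M. x \<otimes> inv y \<in> U)"
      by (intro exI[of _ "s ` (M \<inter> M')"]) blast
  qed
  moreover have "filtermap s F \<le> principal (carrier G)"
    using M(1) sc by (auto simp: le_principal eventually_filtermap elim: eventually_mono)
  moreover have "filtermap s F \<noteq> bot" using F(2) by (simp add: filtermap_bot_iff)
  ultimately obtain l where l: "limitin X (\<lambda>x. x) l (filtermap s F)"
    using complete unfolding group_complete_def by blast
  then have lc: "l \<in> carrier G" by (simp add: limitin_def)
  \<comment> \<open>Shifting the limit of the lifts back by \<open>g0\<close> and projecting undoes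
    the section.\<close>
  have "limitin Q (\<lambda>x. x) (proj (l \<otimes> g0)) F"
    unfolding limitin_def
  proof (intro conjI allI impI)
    show "proj (l \<otimes> g0) \<in> topspace Q" unfolding topspace_Q carrier_quot by (intro imageI) (use lc g0 in simp)
    fix U assume U: "openin Q U \<and> proj (l \<otimes> g0) \<in> U"
    then have "openin X {x \<in> carrier G. proj x \<in> U}"
      using openin_continuous_map_preimage[OF continuous_proj] by auto
    from openin_translate[OF this g0(1)]
    have "\<forall>\<^sub>F c in F. s c \<in> {x \<in> carrier G. x \<otimes> g0 \<in> {x \<in> carrier G. proj x \<in> U}}"
      using l U lc g0 unfolding limitin_def eventually_filtermap by auto
    with M(1) show "\<forall>\<^sub>F x in F. x \<in> U"
    proof (rule eventually_elim2)
      fix c assume "c \<in> M" "s c \<in> {x \<in> carrier G. x \<otimes> g0 \<in> {x \<in> carrier G. proj x \<in> U}}"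
      then show "c \<in> U" using sp[of c] by simp
    qed
  qed
  then show "\<exists>l. limitin Q (\<lambda>x. x) l F" by blast
qed

end

section \<open>The base group, products, and their completeness\<close>

lemma topological_abelian_additive_UNIV:
  "topological_abelian (additive_group (UNIV :: 'a::topological_ab_group_add set)) euclidean"
proof -
  interpret comm_group "additive_group (UNIV :: 'a set)" by (rule comm_group_additive_group_UNIV)
  have "continuous_on UNIV (\<lambda>p :: 'a \<times> 'a. fst p + snd p)" "continuous_on UNIV (\<lambda>x :: 'a. - x)"
    by (intro continuous_intros)+
  then show ?thesis
    by unfold_locales (auto simp: case_prod_unfold inv_additive_group_UNIV)
qed

lemma topological_abelian_DirProd:
  assumes "topological_abelian G X" "topological_abelian H Y"
  shows "topological_abelian (G \<times>\<times> H) (prod_topology X Y)"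
proof -
  interpret G: topological_abelian G X by fact
  interpret H: topological_abelian H Y by fact
  interpret group "G \<times>\<times> H"
    using G.is_group H.is_group by (rule DirProd_group)
  interpret comm_group "G \<times>\<times> H"
    by (rule group_comm_groupI) (auto simp: G.m_comm H.m_comm)
  let ?XY = "prod_topology X Y"
  show ?thesis
  proof
    show "topspace ?XY = carrier (G \<times>\<times> H)" by simp
    have G: "continuous_map (prod_topology ?XY ?XY) X (\<lambda>p. (\<lambda>(x, y). x \<otimes>\<^bsub>G\<^esub> y) (fst (fst p), fst (snd p)))"
      by (rule continuous_map_compose[OF _ G.continuous_mult, unfolded comp_def])
         (intro continuous_map_pairedI
           continuous_map_compose[OF continuous_map_fst continuous_map_fst, unfolded comp_def]
           continuous_map_compose[OF continuous_map_snd continuous_map_fst, unfolded comp_def])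
    have H: "continuous_map (prod_topology ?XY ?XY) Y (\<lambda>p. (\<lambda>(x, y). x \<otimes>\<^bsub>H\<^esub> y) (snd (fst p), snd (snd p)))"
      by (rule continuous_map_compose[OF _ H.continuous_mult, unfolded comp_def])
         (intro continuous_map_pairedI
           continuous_map_compose[OF continuous_map_fst continuous_map_snd, unfolded comp_def]
           continuous_map_compose[OF continuous_map_snd continuous_map_snd, unfolded comp_def])
    show "continuous_map (prod_topology ?XY ?XY) ?XY (\<lambda>(x, y). x \<otimes>\<^bsub>G \<times>\<times> H\<^esub> y)"
      using continuous_map_pairedI[OF G H] by (simp add: case_prod_unfold mult_DirProd')
    have "continuous_map ?XY ?XY (\<lambda>p. (inv\<^bsub>G\<^esub> fst p, inv\<^bsub>H\<^esub> snd p))"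
      by (intro continuous_map_pairedI
          continuous_map_compose[OF continuous_map_fst G.continuous_inv, unfolded comp_def]
          continuous_map_compose[OF continuous_map_snd H.continuous_inv, unfolded comp_def])
    then show "continuous_map ?XY ?XY (\<lambda>p. inv\<^bsub>G \<times>\<times> H\<^esub> p)"
      by (rule continuous_map_eq) (auto simp: inv_DirProd G.is_group H.is_group)
  qed
qed

lemma group_complete_DirProd:
  assumes "topological_abelian G X" "topological_abelian H Y"
    and "group_complete G X" "group_complete H Y"
  shows "group_complete (G \<times>\<times> H) (prod_topology X Y)"
  unfolding group_complete_def
proof (intro allI impI, elim conjE)
  interpret G: topological_abelian G X by fact
  interpret H: topological_abelian H Y by fact
  fix F assume F: "F \<le> principal (carrier (G \<times>\<times> H))" "F \<noteq> bot"
    "group_cauchy_filter (G \<times>\<times> H) (prod_topology X Y) F"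
  have carr: "\<forall>\<^sub>F p in F. p \<in> carrier G \<times> carrier H" using F(1) by (simp add: le_principal)
  have cauchy: "\<exists>M. (\<forall>\<^sub>F p in F. p \<in> M) \<and> (\<forall>p\<in>M. \<forall>q\<in>M.
      fst p \<in> carrier G \<and> snd p \<in> carrier H \<and>
      fst p \<otimes>\<^bsub>G\<^esub> inv\<^bsub>G\<^esub> fst q \<in> U \<and> snd p \<otimes>\<^bsub>H\<^esub> inv\<^bsub>H\<^esub> snd q \<in> V)"
    if "openin X U" "\<one>\<^bsub>G\<^esub> \<in> U" "openin Y V" "\<one>\<^bsub>H\<^esub> \<in> V" for U V
  proof -
    have "openin (prod_topology X Y) (U \<times> V)" "\<one>\<^bsub>G \<times>\<times> H\<^esub> \<in> U \<times> V"
      using that by (auto simp: openin_prod_Times_iff)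
    then obtain M where M: "\<forall>\<^sub>F p in F. p \<in> M"
      "\<forall>p\<in>M. \<forall>q\<in>M. p \<otimes>\<^bsub>G \<times>\<times> H\<^esub> inv\<^bsub>G \<times>\<times> H\<^esub> q \<in> U \<times> V"
      using F(3) unfolding group_cauchy_filter_iff by meson
    show ?thesis
    proof (intro exI conjI)
      \<comment> \<open>Cutting \<open>M\<close> down to the carrier makes the inverse in the
        product componentwise.\<close>
      show "\<forall>\<^sub>F p in F. p \<in> M \<inter> (carrier G \<times> carrier H)"
        using eventually_conj[OF M(1) carr] by simp
      show "\<forall>p\<in>M \<inter> (carrier G \<times> carrier H). \<forall>q\<in>M \<inter> (carrier G \<times> carrier H).
        fst p \<in> carrier G \<and> snd p \<in> carrier H \<and>
        fst p \<otimes>\<^bsub>G\<^esub> inv\<^bsub>G\<^esub> fst q \<in> U \<and> snd p \<otimes>\<^bsub>H\<^esub> inv\<^bsub>H\<^esub> snd q \<in> V"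
      proof (intro ballI)
        fix p q assume pq: "p \<in> M \<inter> (carrier G \<times> carrier H)" "q \<in> M \<inter> (carrier G \<times> carrier H)"
        then have "p \<otimes>\<^bsub>G \<times>\<times> H\<^esub> inv\<^bsub>G \<times>\<times> H\<^esub> q \<in> U \<times> V" using M(2) by blast
        moreover have "inv\<^bsub>G \<times>\<times> H\<^esub> q = (inv\<^bsub>G\<^esub> fst q, inv\<^bsub>H\<^esub> snd q)"
          using pq inv_DirProd[OF G.is_group H.is_group, of "fst q" "snd q"] by auto
        ultimately show "fst p \<in> carrier G \<and> snd p \<in> carrier H \<and>
            fst p \<otimes>\<^bsub>G\<^esub> inv\<^bsub>G\<^esub> fst q \<in> U \<and> snd p \<otimes>\<^bsub>H\<^esub> inv\<^bsub>H\<^esub> snd q \<in> V"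
          using pq by (auto simp: mult_DirProd')
      qed
    qed
  qed
  \<comment> \<open>Using the whole carrier as neighbourhood in one factor isolates the Cauchy
    condition in the other.\<close>
  have openX: "openin X (carrier G)" and openY: "openin Y (carrier H)"
    using openin_topspace[of X] openin_topspace[of Y] unfolding G.topspace_eq H.topspace_eq .
  have "group_cauchy_filter G X (filtermap fst F)"
    unfolding group_cauchy_filter_iff
  proof (intro allI impI, elim conjE)
    fix U assume U: "openin X U" "\<one>\<^bsub>G\<^esub> \<in> U"
    obtain M where M: "\<forall>\<^sub>F p in F. p \<in> M" "\<forall>p\<in>M. \<forall>q\<in>M. fst p \<otimes>\<^bsub>G\<^esub> inv\<^bsub>G\<^esub> fst q \<in> U"
      using cauchy[OF U openY H.one_closed] by (elim exE conjE) simp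
    then show "\<exists>M. (\<forall>\<^sub>F x in filtermap fst F. x \<in> M) \<and> (\<forall>x\<in>M. \<forall>y\<in>M. x \<otimes>\<^bsub>G\<^esub> inv\<^bsub>G\<^esub> y \<in> U)"
      by (intro exI[of _ "fst ` M"]) (auto simp: eventually_filtermap elim: eventually_mono)
  qed
  moreover have "filtermap fst F \<le> principal (carrier G)"
    using carr by (auto simp: le_principal eventually_filtermap elim: eventually_mono)
  ultimately obtain l where l: "limitin X (\<lambda>x. x) l (filtermap fst F)"
    using assms(3) F(2) unfolding group_complete_def by (metis filtermap_bot_iff)
  have "group_cauchy_filter H Y (filtermap snd F)"
    unfolding group_cauchy_filter_iff
  proof (intro allI impI, elim conjE)
    fix V assume V: "openin Y V" "\<one>\<^bsub>H\<^esub> \<in> V"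
    obtain M where M: "\<forall>\<^sub>F p in F. p \<in> M" "\<forall>p\<in>M. \<forall>q\<in>M. snd p \<otimes>\<^bsub>H\<^esub> inv\<^bsub>H\<^esub> snd q \<in> V"
      using cauchy[OF openX G.one_closed V] by (elim exE conjE) simp
    then show "\<exists>M. (\<forall>\<^sub>F x in filtermap snd F. x \<in> M) \<and> (\<forall>x\<in>M. \<forall>y\<in>M. x \<otimes>\<^bsub>H\<^esub> inv\<^bsub>H\<^esub> y \<in> V)"
      by (intro exI[of _ "snd ` M"]) (auto simp: eventually_filtermap elim: eventually_mono)
  qed
  moreover have "filtermap snd F \<le> principal (carrier H)"
    using carr by (auto simp: le_principal eventually_filtermap elim: eventually_mono)
  ultimately obtain m where m: "limitin Y (\<lambda>x. x) m (filtermap snd F)"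
    using assms(4) F(2) unfolding group_complete_def by (metis filtermap_bot_iff)
  have "limitin (prod_topology X Y) (\<lambda>p. p) (l, m) F"
    unfolding limitin_pairwise using l m by (simp add: limitin_def eventually_filtermap)
  then show "\<exists>l. limitin (prod_topology X Y) (\<lambda>p. p) l F" by blast
qed

text \<open>A Cauchy filter contains a set lying in a translate of a compact neighbourhood, so it
  has a cluster point; and a Cauchy filter converges to any of its cluster points.\<close>

lemma group_complete_locally_compact:
  assumes "locally_compact_space (euclidean :: 'a::{topological_ab_group_add, t2_space} topology)"
  shows "group_complete (additive_group (UNIV :: 'a set)) euclidean"
  unfolding group_complete_def
proof (intro allI impI, elim conjE)
  fix F :: "'a filter"
  assume F: "F \<noteq> bot" "group_cauchy_filter (additive_group UNIV) euclidean F"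
  interpret topological_abelian "additive_group (UNIV :: 'a set)" euclidean
    by (rule topological_abelian_additive_UNIV)
  have cauchy: "\<exists>M. (\<forall>\<^sub>F x in F. x \<in> M) \<and> (\<forall>x\<in>M. \<forall>y\<in>M. x - y \<in> U)" if "open U" "0 \<in> U" for U
    using F(2) that unfolding group_cauchy_filter_iff by (simp add: inv_additive_group_UNIV)
  obtain U K :: "'a set" where UK: "open U" "compact K" "0 \<in> U" "U \<subseteq> K"
    using assms unfolding locally_compact_space_def by (auto dest: spec[of _ 0])
  obtain M where M: "\<forall>\<^sub>F x in F. x \<in> M" "\<forall>x\<in>M. \<forall>y\<in>M. x - y \<in> U"
    using cauchy[OF UK(1,3)] by blast
  obtain x0 where x0: "x0 \<in> M" using eventually_happens[OF M(1)] F(1) by blast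
  have "compact ((\<lambda>k. k + x0) ` K)"
    by (intro compact_continuous_image continuous_intros UK(2))
  moreover have "\<forall>\<^sub>F x in F. x \<in> (\<lambda>k. k + x0) ` K"
    using M(1)
  proof (rule eventually_mono)
    fix x assume "x \<in> M"
    then have "x - x0 \<in> K" using M(2) x0 UK(4) by blast
    then show "x \<in> (\<lambda>k. k + x0) ` K" by (intro image_eqI[of _ _ "x - x0"]) auto
  qed
  ultimately obtain l where l: "inf (nhds l) F \<noteq> bot"
    using F(1) unfolding compact_filter by blast
  have "((\<lambda>x. x) \<longlongrightarrow> l) F"
  proof (rule topological_tendstoI)
    fix O1 :: "'a set" assume O1: "open O1" "l \<in> O1"
    define O2 where "O2 = {z. z + l \<in> O1}"
    have O2: "openin euclidean O2" "\<one>\<^bsub>additive_group (UNIV :: 'a set)\<^esub> \<in> O2"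
      using O1 openin_translate[of O1 l] by (auto simp: O2_def)
    obtain V where "openin euclidean V" "\<one>\<^bsub>additive_group (UNIV :: 'a set)\<^esub> \<in> V"
      "\<forall>v\<in>V. \<forall>w\<in>V. v \<otimes>\<^bsub>additive_group UNIV\<^esub> inv\<^bsub>additive_group UNIV\<^esub> w \<in> O2"
      by (rule div_neighbourhood_one[OF O2])
    then have V: "open V" "0 \<in> V" "\<forall>v\<in>V. \<forall>w\<in>V. v - w \<in> O2"
      by (simp_all add: inv_additive_group_UNIV)
    obtain M' where M': "\<forall>\<^sub>F x in F. x \<in> M'" "\<forall>x\<in>M'. \<forall>y\<in>M'. x - y \<in> V"
      using cauchy[OF V(1,2)] by blast
    have "open ((\<lambda>y. l - y) -` V)"
      by (intro open_vimage V(1) continuous_intros)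
    then have "\<forall>\<^sub>F y in nhds l. l - y \<in> V"
      using V(2) eventually_nhds_in_open[of "(\<lambda>y. l - y) -` V" l] by simp
    then have "\<forall>\<^sub>F y in inf (nhds l) F. l - y \<in> V \<and> y \<in> M'"
      using M'(1) unfolding eventually_inf by blast
    \<comment> \<open>The point \<open>y\<close> links the filter to its cluster point: for
      \<open>x\<close> in \<open>M'\<close>, \<open>x - l\<close> equals
      \<open>(x - y) - (l - y)\<close>, a difference of two elements of \<open>V\<close>.\<close>
    then obtain y where y: "l - y \<in> V" "y \<in> M'"
      using eventually_happens l by blast
    show "\<forall>\<^sub>F x in F. x \<in> O1"
      using M'(1)
    proof (rule eventually_mono)
      fix x assume "x \<in> M'"
      then have "(x - y) - (l - y) \<in> O2" using M'(2) y V(3) by blast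
      then show "x \<in> O1" by (simp add: O2_def)
    qed
  qed
  then show "\<exists>l. limitin euclidean (\<lambda>x. x) l F" by auto
qed

text \<open>For the pulled-back topology the isomorphism \<open>f\<close> is also a homeomorphism,
  so each clause transports. With \<open>iota\<close> as \<open>f\<close> this yields the statement
  on the mixed topology.\<close>

lemma defines_completion_pullback:
  assumes f: "f \<in> iso A B" and A: "comm_group A" and compl: "defines_completion B X C Z \<psi>"
  shows "defines_completion A (pullback_topology (carrier A) f X) C Z (\<lambda>x. \<psi> (f x))"
proof -
  interpret A: comm_group A by fact
  interpret B: topological_abelian B X
    using compl by (simp add: defines_completion_def topological_abelian_iff)
  let ?X = "pullback_topology (carrier A) f X"
  have fhom: "f \<in> hom A B" and bij: "bij_betw f (carrier A) (carrier B)"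
    using f by (auto simp: iso_def)
  interpret f: group_hom A B f
    by unfold_locales (rule fhom)
  have top: "topspace ?X = carrier A"
    by (auto simp: topspace_pullback_topology)
  have cont_f: "continuous_map ?X X f"
    using continuous_map_pullback[OF continuous_map_id, of "carrier A" f X] by simp
  have image_f: "openin X (f ` U)" if "openin ?X U" for U
  proof -
    obtain V where V: "openin X V" "U = f -` V \<inter> carrier A"
      using \<open>openin ?X U\<close> by (auto simp: openin_pullback_topology)
    have "f ` (f -` V \<inter> carrier A) = V \<inter> f ` carrier A" by blast
    then have "f ` U = V"
      unfolding V(2) bij_betw_imp_surj_on[OF bij] using openin_subset[OF V(1)] by auto
    with V show ?thesis by simp
  qed
  have homeo: "homeomorphic_map ?X X f"
    using bij image_f cont_f
    by (auto simp: homeomorphic_eq_everything_map top bij_betw_def open_map_def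
        intro!: bijective_open_imp_closed_map)
  have "continuous_map (prod_topology ?X ?X) X (\<lambda>p. (\<lambda>(x, y). x \<otimes>\<^bsub>B\<^esub> y) (f (fst p), f (snd p)))"
    by (rule continuous_map_compose[OF _ B.continuous_mult, unfolded comp_def])
       (intro continuous_map_pairedI
         continuous_map_compose[OF continuous_map_fst cont_f, unfolded comp_def]
         continuous_map_compose[OF continuous_map_snd cont_f, unfolded comp_def])
  then have "continuous_map (prod_topology ?X ?X) X (f \<circ> (\<lambda>(x, y). x \<otimes>\<^bsub>A\<^esub> y))"
    by (rule continuous_map_eq) (auto simp: top)
  then have mult: "continuous_map (prod_topology ?X ?X) ?X (\<lambda>(x, y). x \<otimes>\<^bsub>A\<^esub> y)"
    by (rule continuous_map_pullback') (auto simp: top)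
  have "continuous_map ?X X (\<lambda>x. inv\<^bsub>B\<^esub> f x)"
    by (rule continuous_map_compose[OF cont_f B.continuous_inv, unfolded comp_def])
  then have "continuous_map ?X X (f \<circ> (\<lambda>x. inv\<^bsub>A\<^esub> x))"
    by (rule continuous_map_eq) (auto simp: top)
  then have inv: "continuous_map ?X ?X (\<lambda>x. inv\<^bsub>A\<^esub> x)"
    by (rule continuous_map_pullback') (auto simp: top)
  have image: "(\<lambda>x. \<psi> (f x)) ` carrier A = \<psi> ` carrier B"
    using bij unfolding bij_betw_def by (metis image_image)
  have one: "f ` {\<one>\<^bsub>A\<^esub>} = {\<one>\<^bsub>B\<^esub>}" by simp
  have "X closure_of {\<one>\<^bsub>B\<^esub>} = f ` (?X closure_of {\<one>\<^bsub>A\<^esub>})"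
    unfolding one[symmetric] by (rule homeomorphic_map_closure_of[OF homeo]) (simp add: top)
  moreover have "?X closure_of {\<one>\<^bsub>A\<^esub>} \<subseteq> carrier A"
    using closure_of_subset_topspace[of ?X] by (simp add: top)
  ultimately have ker: "kernel A C (\<lambda>x. \<psi> (f x)) = ?X closure_of {\<one>\<^bsub>A\<^esub>}"
    if "kernel B C \<psi> = X closure_of {\<one>\<^bsub>B\<^esub>}"
    using that bij inj_on_image_mem_iff[of f "carrier A"]
    unfolding kernel_def bij_betw_def by blast
  have "open_map ?X W (\<lambda>x. \<psi> (f x))" if "open_map X W \<psi>" for W :: "'e topology"
    using that image_f unfolding open_map_def by (metis image_image)
  moreover have "continuous_map ?X Z (\<lambda>x. \<psi> (f x))" if "continuous_map X Z \<psi>"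
    using continuous_map_compose[OF cont_f that] by (simp add: comp_def)
  moreover have "(\<lambda>x. \<psi> (f x)) \<in> hom A C" if "\<psi> \<in> hom B C"
    using hom_compose[OF fhom that] by (simp add: comp_def)
  moreover have "topological_comm_group A ?X"
    unfolding topological_comm_group_def using A top mult inv by blast
  ultimately show ?thesis
    using compl ker unfolding defines_completion_def image by blast
qed

section \<open>Positive definiteness of the autocorrelation\<close>

text \<open>Absolute summability is the notion that fits, because the weights restricted to
  \<open>S \<inter> A n\<close> have it. It makes \<open>inner_sum\<close> converge
  absolutely.\<close>

definition summable_fun :: "('a \<Rightarrow> complex) \<Rightarrow> bool" where
  "summable_fun f \<longleftrightarrow> (\<lambda>x. cmod (f x)) summable_on UNIV"

definition inner_sum :: "('a \<Rightarrow> complex) \<Rightarrow> ('a \<Rightarrow> complex) \<Rightarrow> complex" where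
  "inner_sum f g = (\<Sum>\<^sub>\<infinity>x. f x * cnj (g x))"

lemma summable_fun_comparison:
  assumes "(g :: 'a \<Rightarrow> real) summable_on UNIV" "\<And>x. cmod (f x) \<le> g x"
  shows "summable_fun f"
proof -
  have "0 \<le> g x" for x using assms(2)[of x] norm_ge_zero[of "f x"] by linarith
  then have "(\<lambda>x. norm (g x)) summable_on UNIV" using assms(1) by simp
  then show ?thesis unfolding summable_fun_def
    by (rule Infinite_Sum.abs_summable_on_comparison_test) (use assms(2) order_trans[OF _ abs_ge_self] in auto)
qed

lemma summable_fun_diff: "summable_fun f \<Longrightarrow> summable_fun g \<Longrightarrow> summable_fun (\<lambda>x. f x - g x)"
  by (rule summable_fun_comparison[where g = "\<lambda>x. cmod (f x) + cmod (g x)"])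
     (auto simp: summable_fun_def norm_triangle_ineq4 intro: summable_on_add)

lemma bij_minus_const: "bij (\<lambda>x :: 'a::ab_group_add. x - s)"
  by (rule bij_betwI[where g = "\<lambda>x. x + s"]) auto

lemma summable_fun_shift:
  fixes f :: "'a::ab_group_add \<Rightarrow> complex"
  assumes "summable_fun f" shows "summable_fun (\<lambda>x. f (x - s))"
  using assms summable_on_reindex_bij_betw[OF bij_minus_const, of "\<lambda>x. cmod (f x)" s]
  by (simp add: summable_fun_def)

text \<open>An absolutely summable function is bounded, here by its own sum
  \<open>B\<close>.\<close>

lemma summable_fun_mult:
  assumes f: "summable_fun f" and g: "summable_fun g"
  shows "summable_fun (\<lambda>x. f x * cnj (g x))"
proof (rule summable_fun_comparison)
  define B where "B = (\<Sum>\<^sub>\<infinity>x. cmod (g x))"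
  show "(\<lambda>x. cmod (f x) * B) summable_on UNIV"
    using f unfolding summable_fun_def by (rule summable_on_cmult_left)
  fix x
  have "cmod (g x) \<le> B"
    using finite_sum_le_infsum[of "\<lambda>x. cmod (g x)" UNIV "{x}"] g by (simp add: B_def summable_fun_def)
  then show "cmod (f x * cnj (g x)) \<le> cmod (f x) * B"
    by (simp add: norm_mult mult_left_mono)
qed

lemma summable_inner:
  assumes "summable_fun f" "summable_fun g" shows "(\<lambda>x. f x * cnj (g x)) summable_on UNIV"
  using summable_fun_mult[OF assms] unfolding summable_fun_def by (rule Infinite_Sum.abs_summable_summable)

lemma infsum_diff:
  fixes f g :: "'a \<Rightarrow> 'b::{topological_ab_group_add, t2_space}"
  assumes "f summable_on A" "g summable_on A"
  shows "infsum (\<lambda>x. f x - g x) A = infsum f A - infsum g A"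
  using infsum_add[OF assms(1), of "\<lambda>x. - g x"] assms(2) by (simp add: infsum_uminus summable_on_uminus)

lemma inner_sum_diff_left:
  assumes "summable_fun f" "summable_fun g" "summable_fun h"
  shows "inner_sum (\<lambda>x. f x - g x) h = inner_sum f h - inner_sum g h"
  unfolding inner_sum_def left_diff_distrib
  by (intro infsum_diff summable_inner assms)

lemma inner_sum_diff_right:
  assumes "summable_fun f" "summable_fun g" "summable_fun h"
  shows "inner_sum h (\<lambda>x. f x - g x) = inner_sum h f - inner_sum h g"
  unfolding inner_sum_def complex_cnj_diff right_diff_distrib
  by (intro infsum_diff summable_inner assms)

lemma cnj_inner_sum: "cnj (inner_sum f g) = inner_sum g f"
  unfolding inner_sum_def infsum_cnj[symmetric] by (simp add: mult.commute)

lemma inner_sum_shift: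
  fixes f g :: "'a::ab_group_add \<Rightarrow> complex"
  shows "inner_sum (\<lambda>x. f (x - s)) (\<lambda>x. g (x - s)) = inner_sum f g"
  unfolding inner_sum_def
  by (rule infsum_reindex_bij_betw[OF bij_minus_const])

lemma inner_sum_self:
  assumes "summable_fun f"
  shows "(\<lambda>x. (cmod (f x))\<^sup>2) summable_on UNIV"
    and "complex_of_real (\<Sum>\<^sub>\<infinity>x. (cmod (f x))\<^sup>2) = inner_sum f f"
proof -
  have eq: "f x * cnj (f x) = complex_of_real ((cmod (f x))\<^sup>2)" for x
    by (rule complex_norm_square[symmetric])
  from summable_fun_mult[OF assms assms]
  show s: "(\<lambda>x. (cmod (f x))\<^sup>2) summable_on UNIV"
    by (simp add: summable_fun_def norm_mult power2_eq_square)
  then have "((\<lambda>x. (cmod (f x))\<^sup>2) has_sum (\<Sum>\<^sub>\<infinity>x. (cmod (f x))\<^sup>2)) UNIV" by simp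
  then have "((\<lambda>x. complex_of_real ((cmod (f x))\<^sup>2)) has_sum
      complex_of_real (\<Sum>\<^sub>\<infinity>x. (cmod (f x))\<^sup>2)) UNIV"
    by (simp only: has_sum_of_real_iff)
  then show "complex_of_real (\<Sum>\<^sub>\<infinity>x. (cmod (f x))\<^sup>2) = inner_sum f f"
    unfolding inner_sum_def eq by (rule infsumI[symmetric])
qed

text \<open>The finite inequality bounds every partial sum by the same product of norms, so the
  bound survives for the infinite sum.\<close>

lemma Cauchy_Schwarz_inner_sum:
  assumes f: "summable_fun f" and g: "summable_fun g"
  shows "(cmod (inner_sum f g))\<^sup>2 \<le> Re (inner_sum f f) * Re (inner_sum g g)"
proof -
  define A where "A = (\<Sum>\<^sub>\<infinity>x. (cmod (f x))\<^sup>2)"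
  define B where "B = (\<Sum>\<^sub>\<infinity>x. (cmod (g x))\<^sup>2)"
  have AB: "A \<ge> 0" "B \<ge> 0" unfolding A_def B_def by (simp_all add: infsum_nonneg)
  have s: "(\<lambda>x. cmod (f x * cnj (g x))) summable_on UNIV"
    using summable_fun_mult[OF f g] by (simp add: summable_fun_def)
  have "cmod (inner_sum f g) \<le> (\<Sum>\<^sub>\<infinity>x. cmod (f x * cnj (g x)))"
    unfolding inner_sum_def by (rule norm_infsum_bound[OF s])
  also have "\<dots> \<le> sqrt A * sqrt B"
  proof (rule infsum_le_finite_sums[OF s])
    fix F :: "'a set" assume F: "finite F"
    have "(\<Sum>x\<in>F. cmod (f x * cnj (g x))) = (\<Sum>x\<in>F. \<bar>cmod (f x)\<bar> * \<bar>cmod (g x)\<bar>)"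
      by (simp add: norm_mult)
    also have "\<dots> \<le> L2_set (\<lambda>x. cmod (f x)) F * L2_set (\<lambda>x. cmod (g x)) F"
      by (rule L2_set_mult_ineq)
    also have "\<dots> \<le> sqrt A * sqrt B"
      unfolding L2_set_def A_def B_def
      by (intro mult_mono real_sqrt_le_mono finite_sum_le_infsum inner_sum_self(1) f g F)
         (auto intro!: sum_nonneg infsum_nonneg)
    finally show "(\<Sum>x\<in>F. cmod (f x * cnj (g x))) \<le> sqrt A * sqrt B" .
  qed
  finally have "(cmod (inner_sum f g))\<^sup>2 \<le> (sqrt A * sqrt B)\<^sup>2"
    by (rule power_mono) simp
  also have "\<dots> = A * B" using AB by (simp add: power_mult_distrib)
  also have "A = Re (inner_sum f f)" unfolding A_def by (simp flip: inner_sum_self(2)[OF f])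
  also have "B = Re (inner_sum g g)" unfolding B_def by (simp flip: inner_sum_self(2)[OF g])
  finally show ?thesis .
qed

text \<open>The convolution of \<open>f\<close> with its reflected conjugate, a positive definite
  function.\<close>

definition autocorr_fun :: "('a::ab_group_add \<Rightarrow> complex) \<Rightarrow> 'a \<Rightarrow> complex" where
  "autocorr_fun f z = inner_sum f (\<lambda>x. f (x - z))"

text \<open>Apply Cauchy--Schwarz to \<open>f - f(\<cdot> - s)\<close> and \<open>f(\<cdot> - s) - f(\<cdot> - (s + t))\<close>. The resulting
  inequality is homogeneous in \<open>c\<close> and stable under pointwise limits, so it passes to \<open>\<eta>\<close>, and
  it is what the triangle inequality for \<open>\<varrho>\<close> needs.\<close>

lemma autocorr_fun_inequality:
  fixes f :: "'a::ab_group_add \<Rightarrow> complex"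
  assumes f: "summable_fun f"
  defines "c \<equiv> autocorr_fun f"
  shows "(cmod (c s + c t - c (s + t) - c 0))\<^sup>2 \<le> 4 * cmod (c 0 - c s) * cmod (c 0 - c t)"
proof -
  define U where "U s = (\<lambda>x. f (x - s))" for s
  have U: "summable_fun (U s)" for s unfolding U_def by (rule summable_fun_shift[OF f])
  \<comment> \<open>The Gram matrix of the translates of \<open>f\<close> depends on differences
    only, so all inner products below are values of \<open>c\<close>.\<close>
  have inner_U: "inner_sum (U s) (U t) = c (t - s)" for s t
    using inner_sum_shift[of f s "\<lambda>x. f (x - (t - s))"]
    by (simp add: c_def autocorr_fun_def U_def algebra_simps)
  have c_minus: "c (- s) = cnj (c s)" for s
    using cnj_inner_sum[of "U 0" "U s"] inner_U[of 0 s] inner_U[of s 0] by simp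
  define a where "a = (\<lambda>x. U 0 x - U s x)"
  define b where "b = (\<lambda>x. U s x - U (s + t) x)"
  have a: "summable_fun a" and b: "summable_fun b"
    unfolding a_def b_def using U by (auto intro: summable_fun_diff)
  have diff: "inner_sum (\<lambda>x. U p x - U q x) (\<lambda>x. U r x - U u x) =
      c (r - p) - c (u - p) - (c (r - q) - c (u - q))" for p q r u
    using U by (simp add: inner_sum_diff_left inner_sum_diff_right summable_fun_diff inner_U)
  have "inner_sum a b = - (c 0 - c s - c t + c (s + t))"
    unfolding a_def b_def diff by simp
  then have ab: "c s + c t - c (s + t) - c 0 = inner_sum a b" by simp
  have "inner_sum a a = 2 * c 0 - c s - cnj (c s)"
    unfolding a_def diff by (simp add: c_minus)
  \<comment> \<open>Taking real parts merges \<open>c s\<close> with its conjugate; bounding by the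
    modulus then gives the quantity that enters \<open>ac_dist\<close>.\<close>
  then have "Re (inner_sum a a) = 2 * Re (c 0 - c s)" by simp
  then have aa: "Re (inner_sum a a) \<le> 2 * cmod (c 0 - c s)"
    using complex_Re_le_cmod[of "c 0 - c s"] by simp
  have "inner_sum b b = 2 * c 0 - c t - c (- t)"
    unfolding b_def diff by simp
  then have "Re (inner_sum b b) = 2 * Re (c 0 - c t)" by (simp add: c_minus)
  then have bb: "Re (inner_sum b b) \<le> 2 * cmod (c 0 - c t)"
    using complex_Re_le_cmod[of "c 0 - c t"] by simp
  have nonneg: "0 \<le> Re (inner_sum b b)"
    unfolding inner_sum_self(2)[OF b, symmetric] by (simp add: infsum_nonneg)
  have "(cmod (inner_sum a b))\<^sup>2 \<le> Re (inner_sum a a) * Re (inner_sum b b)"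
    by (rule Cauchy_Schwarz_inner_sum[OF a b])
  also have "\<dots> \<le> (2 * cmod (c 0 - c s)) * (2 * cmod (c 0 - c t))"
    by (rule mult_mono[OF aa bb _ nonneg]) simp
  finally show ?thesis unfolding ab by simp
qed

section \<open>Passage to the limit and the triangle inequality for the pseudo-metric\<close>

lemma summable_fun_restrict:
  assumes fin: "(\<Sum>\<^sub>\<infinity>x\<in>T. ennreal (cmod (w x))) < \<infinity>"
  shows "summable_fun (\<lambda>x. if x \<in> T then w x else 0)"
proof -
  define r where "r = (\<Sum>\<^sub>\<infinity>x\<in>T. ennreal (cmod (w x)))"
  have "(\<lambda>x. cmod (w x)) summable_on T"
  proof (rule nonneg_bdd_above_summable_on)
    show "bdd_above (sum (\<lambda>x. cmod (w x)) ` {F. F \<subseteq> T \<and> finite F})"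
    proof (rule bdd_aboveI2)
      fix F assume F: "F \<in> {F. F \<subseteq> T \<and> finite F}"
      have "ennreal (\<Sum>x\<in>F. cmod (w x)) = (\<Sum>x\<in>F. ennreal (cmod (w x)))"
        by (simp add: sum_ennreal)
      also have "\<dots> \<le> r"
        unfolding r_def by (subst nonneg_infsum_complete) (use F in \<open>auto intro!: SUP_upper\<close>)
      \<comment> \<open>Finiteness of the extended sum turns it into a real bound for all partial
        sums.\<close>
      also have "r = ennreal (enn2real r)" using fin unfolding r_def by simp
      finally show "(\<Sum>x\<in>F. cmod (w x)) \<le> enn2real r" by (simp add: ennreal_le_iff)
    qed
  qed simp
  then show ?thesis unfolding summable_fun_def
    by (rule summable_on_cong_neutral[THEN iffD1, rotated -1]) auto
qed

text \<open>A pair with difference \<open>z\<close> is determined by its first entry, and extending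
  the truncated weight by zero turns the sum over pairs into an inner product. Off the difference
  set no pair contributes, which agrees with the default value 0.\<close>

lemma autocorr_approx_eq:
  "autocorr_approx \<theta> A S w n z = 1 / complex_of_real (measure \<theta> (A n)) *
     autocorr_fun (\<lambda>x. if x \<in> S \<inter> A n then w x else 0) z"
proof -
  define T where "T = S \<inter> A n"
  define f where "f = (\<lambda>x. if x \<in> T then w x else 0)"
  define D where "D = {x. x \<in> T \<and> x - z \<in> T}"
  have "{(x, y). x \<in> T \<and> y \<in> T \<and> x - y = z} = (\<lambda>x. (x, x - z)) ` D"
    by (auto simp: D_def image_iff)
  then have "(\<Sum>\<^sub>\<infinity>(x, y)\<in>{(x, y). x \<in> T \<and> y \<in> T \<and> x - y = z}. w x * cnj (w y)) =
      (\<Sum>\<^sub>\<infinity>x\<in>D. w x * cnj (w (x - z)))"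
    by (simp add: infsum_reindex inj_on_def comp_def)
  also have "\<dots> = autocorr_fun f z"
    unfolding autocorr_fun_def inner_sum_def
    by (rule infsum_cong_neutral) (auto simp: D_def f_def)
  finally have eq: "(\<Sum>\<^sub>\<infinity>(x, y)\<in>{(x, y). x \<in> T \<and> y \<in> T \<and> x - y = z}. w x * cnj (w y)) =
      autocorr_fun f z" .
  show ?thesis
  proof (cases "z \<in> difference_set S")
    case True
    then show ?thesis using eq by (simp add: autocorr_approx_def T_def f_def)
  next
    case False
    then have "f x * cnj (f (x - z)) = 0" for x
      by (auto simp: f_def T_def difference_set_def)
    then have "autocorr_fun f z = 0" unfolding autocorr_fun_def inner_sum_def by (simp only: infsum_0_simp)
    then show ?thesis using False by (simp add: autocorr_approx_def T_def f_def)
  qed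
qed

text \<open>The comb has finite variation on the compact closure of \<open>A n\<close>, so the
  truncated weights are summable and satisfy the inequality for each \<open>n\<close>; both sides
  are continuous in the values of the approximants.\<close>

lemma autocorr_inequality:
  assumes "comb_measure S w" "\<And>n. compact (closure (A n))"
    and lim: "\<And>z. z \<in> difference_set S \<Longrightarrow> (\<lambda>n. autocorr_approx \<theta> A S w n z) \<longlonglongrightarrow> \<eta> z"
    and zero: "\<And>z. z \<notin> difference_set S \<Longrightarrow> \<eta> z = 0"
  shows "(cmod (\<eta> s + \<eta> t - \<eta> (s + t) - \<eta> 0))\<^sup>2 \<le> 4 * cmod (\<eta> 0 - \<eta> s) * cmod (\<eta> 0 - \<eta> t)"
proof -
  define e where "e n z = autocorr_approx \<theta> A S w n z" for n z
  \<comment> \<open>Off the difference set the approximants and \<open>\<eta>\<close> all vanish, so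
    convergence holds on the whole group.\<close>
  have lim': "(\<lambda>n. e n z) \<longlonglongrightarrow> \<eta> z" for z
    using lim zero by (cases "z \<in> difference_set S") (auto simp: e_def autocorr_approx_def)
  have "(cmod (e n s + e n t - e n (s + t) - e n 0))\<^sup>2
      \<le> 4 * cmod (e n 0 - e n s) * cmod (e n 0 - e n t)" for n
  proof -
    define f where "f = (\<lambda>x. if x \<in> S \<inter> A n then w x else 0)"
    define k where "k = 1 / complex_of_real (measure \<theta> (A n))"
    have "(\<Sum>\<^sub>\<infinity>x\<in>S \<inter> A n. ennreal (cmod (w x))) \<le> (\<Sum>\<^sub>\<infinity>x\<in>S \<inter> closure (A n). ennreal (cmod (w x)))"
      by (rule infsum_mono_neutral) (use closure_subset in \<open>auto simp: nonneg_summable_on_complete\<close>)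
    also have "\<dots> < \<infinity>" using assms(1,2) by (simp add: comb_measure_def)
    finally have "summable_fun f" unfolding f_def by (rule summable_fun_restrict)
    note ineq = autocorr_fun_inequality[OF this, of s t]
    have e: "e n z = k * autocorr_fun f z" for z
      unfolding e_def autocorr_approx_eq k_def f_def ..
    have "e n s + e n t - e n (s + t) - e n 0 =
        k * (autocorr_fun f s + autocorr_fun f t - autocorr_fun f (s + t) - autocorr_fun f 0)"
      "e n 0 - e n s = k * (autocorr_fun f 0 - autocorr_fun f s)"
      "e n 0 - e n t = k * (autocorr_fun f 0 - autocorr_fun f t)"
      by (simp_all add: e algebra_simps)
    \<comment> \<open>Both sides are quadratic in the normalising factor, so it comes out as the
      square of \<open>cmod k\<close>.\<close>
    then show ?thesis
      using mult_left_mono[OF ineq, of "(cmod k)\<^sup>2"]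
      by (simp add: norm_mult power_mult_distrib power2_eq_square mult_ac)
  qed
  then show ?thesis
    by (intro LIMSEQ_le[where X = "\<lambda>n. (cmod (e n s + e n t - e n (s + t) - e n 0))\<^sup>2"
          and Y = "\<lambda>n. 4 * cmod (e n 0 - e n s) * cmod (e n 0 - e n t)"])
       (auto intro!: tendsto_intros lim')
qed

text \<open>With \<open>d z = cmod (\<eta> 0 - \<eta> z)\<close>, the hypothesis bounds the defect
  of additivity by \<open>2 * sqrt (d s) * sqrt (d t)\<close>, exactly the cross term that completes
  the square of \<open>sqrt (d s) + sqrt (d t)\<close>. This explains the square root in
  \<open>ac_dist\<close>.\<close>

lemma ac_dist_triangle:
  assumes ineq: "\<And>s t. (cmod (\<eta> s + \<eta> t - \<eta> (s + t) - \<eta> 0))\<^sup>2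
      \<le> 4 * cmod (\<eta> 0 - \<eta> s) * cmod (\<eta> 0 - \<eta> t)"
    and nz: "\<eta> 0 \<noteq> 0"
  shows "ac_dist \<eta> x z \<le> ac_dist \<eta> x y + ac_dist \<eta> y z"
proof -
  define d where "d z = cmod (\<eta> 0 - \<eta> z)" for z
  have tri: "sqrt (d (s + t)) \<le> sqrt (d s) + sqrt (d t)" for s t
  proof -
    have "(cmod (\<eta> s + \<eta> t - \<eta> (s + t) - \<eta> 0))\<^sup>2 \<le> (2 * sqrt (d s) * sqrt (d t))\<^sup>2"
      using ineq[of s t] by (simp add: d_def power_mult_distrib)
    then have E: "cmod (\<eta> s + \<eta> t - \<eta> (s + t) - \<eta> 0) \<le> 2 * sqrt (d s) * sqrt (d t)"
      by (rule power2_le_imp_le) (simp add: d_def)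
    have "\<eta> 0 - \<eta> (s + t) = (\<eta> 0 - \<eta> s) + (\<eta> 0 - \<eta> t) + (\<eta> s + \<eta> t - \<eta> (s + t) - \<eta> 0)"
      by simp
    then have "d (s + t) \<le> d s + d t + cmod (\<eta> s + \<eta> t - \<eta> (s + t) - \<eta> 0)"
      unfolding d_def by (metis norm_triangle_mono norm_triangle_ineq order_refl)
    also have "\<dots> \<le> (sqrt (d s) + sqrt (d t))\<^sup>2"
      using E by (simp add: power2_sum d_def)
    finally show ?thesis by (intro real_le_lsqrt) (auto simp: d_def)
  qed
  have "ac_dist \<eta> s t = sqrt (d (s - t)) / sqrt (cmod (\<eta> 0))" for s t
  proof -
    have "1 - \<eta> (s - t) / \<eta> 0 = (\<eta> 0 - \<eta> (s - t)) / \<eta> 0" using nz by (simp add: diff_divide_distrib)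
    then show ?thesis by (simp add: ac_dist_def d_def norm_divide real_sqrt_divide)
  qed
  then show ?thesis using tri[of "x - y" "y - z"]
    by (simp add: add_divide_distrib[symmetric] divide_right_mono)
qed

section \<open>The induced map\<close>

locale ac_completion =
  fixes \<eta> :: "'a::{topological_ab_group_add, t2_space} \<Rightarrow> complex"
    and H (structure) and Y and \<phi>
  assumes completion: "defines_completion (additive_group (ac_L \<eta>)) (ac_topology \<eta>) H Y \<phi>"
    and locally_compact: "locally_compact_space (euclidean :: 'a topology)"
    and triangle: "ac_dist \<eta> x z \<le> ac_dist \<eta> x y + ac_dist \<eta> y z"
    and eta_0: "\<eta> 0 \<noteq> 0"
    and isolated: \<comment> \<open>the sign matches \<open>ac_dist \<eta> 0 z\<close>, which evaluates \<open>\<eta>\<close> at \<open>- z\<close>\<close>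
      "\<exists>U. open U \<and> 0 \<in> U \<and> (\<forall>z\<in>U. \<eta> (- z) \<noteq> 0 \<longrightarrow> z = 0)"
begin

abbreviation L where "L \<equiv> ac_L \<eta>"
abbreviation \<pi> where "\<pi> p \<equiv> L_tilde \<eta> \<phi> #>\<^bsub>GH_group H\<^esub> p"
abbreviation \<alpha> where "\<alpha> p \<equiv> alpha_L \<eta> #>\<^bsub>GL_group \<eta>\<^esub> p"

sublocale L: topological_abelian "additive_group L" "ac_topology \<eta>"
  using completion by (simp add: defines_completion_def topological_abelian_iff)

sublocale H: topological_abelian H Y
  using completion by (simp add: defines_completion_def topological_abelian_iff)

lemma Hausdorff_Y: "Hausdorff_space Y" and complete_Y: "group_complete H Y"
  and phi_hom: "\<phi> \<in> hom (additive_group L) H"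
  and continuous_phi: "continuous_map (ac_topology \<eta>) Y \<phi>"
  and dense_phi: "Y closure_of (\<phi> ` L) = carrier H"
  and open_phi: "open_map (ac_topology \<eta>) (subtopology Y (\<phi> ` L)) \<phi>"
  and kernel_phi: "kernel (additive_group L) H \<phi> = ac_topology \<eta> closure_of {0}"
  using completion by (simp_all add: defines_completion_def)

sublocale phi: group_hom "additive_group L" H \<phi>
  by unfold_locales (rule phi_hom)

lemma phi_closed: "t \<in> L \<Longrightarrow> \<phi> t \<in> carrier H"
  using phi.hom_closed by simp

lemma phi_add: "s \<in> L \<Longrightarrow> t \<in> L \<Longrightarrow> \<phi> (s + t) = \<phi> s \<otimes> \<phi> t"
  using phi.hom_mult[of s t] by simp

lemma phi_0: "\<phi> 0 = \<one>"
  using phi.hom_one by simp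

lemma inv_L: "t \<in> L \<Longrightarrow> inv\<^bsub>additive_group L\<^esub> t = - t"
  by (rule L.inv_equality) (auto simp: ac_L_closed)

lemma phi_uminus: "t \<in> L \<Longrightarrow> \<phi> (- t) = inv \<phi> t"
  using phi.hom_inv[of t] by (simp add: inv_L)

lemma topspace_ac: "topspace (ac_topology \<eta>) = L"
  using L.topspace_eq by simp

section \<open>The two product groups, their subgroups and the torus\<close>

lemma topological_abelian_GL: "topological_abelian (GL_group \<eta>) (GL_topology \<eta>)"
  unfolding GL_group_def GL_topology_def
  by (rule topological_abelian_DirProd[OF topological_abelian_additive_UNIV L.topological_abelian_axioms])

lemma topological_abelian_GH: "topological_abelian (GH_group H) (prod_topology euclidean Y :: ('a \<times> _) topology)"
  unfolding GH_group_def
  by (rule topological_abelian_DirProd[OF topological_abelian_additive_UNIV H.topological_abelian_axioms])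

text \<open>The diagonal, like the graph of \<open>\<phi>\<close> below, is the image of
  \<open>L\<close> under a homomorphism and hence a subgroup.\<close>

sublocale GL: topological_abelian_quotient "GL_group \<eta>" "GL_topology \<eta>" "alpha_L \<eta>"
proof -
  interpret GL: topological_abelian "GL_group \<eta>" "GL_topology \<eta>" by (rule topological_abelian_GL)
  interpret group_hom "additive_group L" "GL_group \<eta>" "\<lambda>t. (t, t)"
    by unfold_locales (auto simp: hom_def GL_group_def)
  show "topological_abelian_quotient (GL_group \<eta>) (GL_topology \<eta>) (alpha_L \<eta>)"
    using img_is_subgroup
    by (intro topological_abelian_quotient.intro topological_abelian_quotient_axioms.intro
        GL.topological_abelian_axioms) (simp add: alpha_L_def)
qed

sublocale GH: topological_abelian_quotient "GH_group H" "prod_topology euclidean Y" "L_tilde \<eta> \<phi>"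
proof -
  interpret GH: topological_abelian "GH_group H" "prod_topology euclidean Y :: ('a \<times> _) topology"
    by (rule topological_abelian_GH)
  interpret group_hom "additive_group L" "GH_group H" "\<lambda>t. (t, \<phi> t)"
    by unfold_locales (auto simp: hom_def GH_group_def phi_closed phi_add)
  show "topological_abelian_quotient (GH_group H) (prod_topology euclidean Y) (L_tilde \<eta> \<phi>)"
    using img_is_subgroup
    by (intro topological_abelian_quotient.intro topological_abelian_quotient_axioms.intro
        GH.topological_abelian_axioms) (simp add: L_tilde_def)
qed

lemma carrier_GL: "carrier (GL_group \<eta>) = UNIV \<times> L"
  and carrier_GH: "carrier (GH_group H) = (UNIV :: 'a set) \<times> carrier H"
  by (simp_all add: GL_group_def GH_group_def)

lemma GL_topology_eq: "GL_quotient_topology \<eta> = GL.Q"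
  and torus_topology_eq: "torus_topology \<eta> H Y \<phi> = GH.Q"
  by (simp_all add: GL_quotient_topology_def torus_topology_def)

text \<open>A box around the neutral element does it. Its second factor forces a point of
  \<open>L\<close> to be closer than 1 to 0, so \<open>\<eta>\<close> does not vanish at its
  negative; its first factor then leaves only 0.\<close>

lemma L_tilde_discrete:
  "\<exists>O1. openin (prod_topology euclidean Y) O1 \<and> O1 \<inter> L_tilde \<eta> \<phi> = {\<one>\<^bsub>GH_group H\<^esub>}"
proof -
  \<comment> \<open>The radius is 1 because \<open>\<eta> (- t) = 0\<close> gives distance exactly
    1. The centre stands in the first argument, as in
    \<open>openin_pseudometric_topology\<close>.\<close>
  define B where "B = {t \<in> L. ac_dist \<eta> 0 t < 1}"
  have "openin (ac_topology \<eta>) B"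
    unfolding ac_topology_def openin_pseudometric_topology
  proof (intro conjI ballI)
    show "B \<subseteq> L" by (auto simp: B_def)
    fix x assume x: "x \<in> B"
    have "y \<in> B" if "y \<in> L" "ac_dist \<eta> x y < 1 - ac_dist \<eta> 0 x" for y
      using triangle[of 0 y x] that by (simp add: B_def)
    then show "\<exists>r>0. \<forall>y\<in>L. ac_dist \<eta> x y < r \<longrightarrow> y \<in> B"
      using x by (intro exI[of _ "1 - ac_dist \<eta> 0 x"]) (auto simp: B_def)
  qed
  then have openB: "openin (ac_topology \<eta>) B" .
  then have "openin (subtopology Y (\<phi> ` L)) (\<phi> ` B)"
    using open_phi by (simp add: open_map_def)
  then obtain V where V: "openin Y V" "\<phi> ` B = V \<inter> \<phi> ` L"
    by (auto simp: openin_subtopology)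
  have "0 \<in> B" by (simp add: B_def ac_L_closed ac_dist_def eta_0)
  then have "\<phi> 0 \<in> V" using V(2) by blast
  obtain U where U: "open U" "0 \<in> U" "\<forall>z\<in>U. \<eta> (- z) \<noteq> 0 \<longrightarrow> z = 0"
    using isolated by blast
  have eq: "l = 0" if l: "l \<in> L" "l \<in> U" "\<phi> l \<in> V" for l
  proof -
    have "\<phi> l \<in> \<phi> ` B" using l V(2) by blast
    then obtain p where p: "p \<in> B" "\<phi> l = \<phi> p" by blast
    then have pL: "p \<in> L" "p - l \<in> L" "p + - l \<in> L"
      using l ac_L_closed(2)[OF _ ac_L_closed(3)[OF l(1)], of p] by (auto simp: B_def)
    have "\<phi> (p + - l) = \<one>"
      using p pL l by (simp only: phi_add phi_uminus ac_L_closed H.r_inv phi_closed)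
    \<comment> \<open>As \<open>\<phi>\<close> may fail to be injective, \<open>l\<close> is only
      known to agree with \<open>p\<close> modulo the closure of 0. Every open set containing
      \<open>p - l\<close> contains 0; applied to a translate of \<open>B\<close>, this puts
      \<open>l\<close> itself into \<open>B\<close>.\<close>
    then have cl: "p + - l \<in> ac_topology \<eta> closure_of {0}"
      using pL unfolding kernel_phi[symmetric] kernel_def by simp
    have W: "openin (ac_topology \<eta>) {x \<in> L. x + l \<in> B}"
      using L.openin_translate[OF openB, of l] l by simp
    have "p + - l \<in> {x \<in> L. x + l \<in> B}" using p(1) pL by simp
    then have "\<exists>y. y \<in> {0} \<and> y \<in> {x \<in> L. x + l \<in> B}"
      using cl[unfolded in_closure_of, THEN conjunct2, rule_format, of "{x \<in> L. x + l \<in> B}"] W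
      by simp
    then have "0 \<in> {x \<in> L. x + l \<in> B}" by simp
    then have "l \<in> B" by simp
    then have "sqrt (cmod (1 - \<eta> (- l) / \<eta> 0)) < 1" by (simp add: B_def ac_dist_def)
    then have "\<eta> (- l) \<noteq> 0" by auto
    then show "l = 0" using U(3) l by blast
  qed
  have "(U \<times> V) \<inter> L_tilde \<eta> \<phi> = {\<one>\<^bsub>GH_group H\<^esub>}"
  proof (rule subset_antisym)
    show "(U \<times> V) \<inter> L_tilde \<eta> \<phi> \<subseteq> {\<one>\<^bsub>GH_group H\<^esub>}"
    proof
      fix p assume "p \<in> (U \<times> V) \<inter> L_tilde \<eta> \<phi>"
      then obtain l where l: "l \<in> L" "l \<in> U" "\<phi> l \<in> V" "p = (l, \<phi> l)"
        by (auto simp: L_tilde_def)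
      then show "p \<in> {\<one>\<^bsub>GH_group H\<^esub>}"
        using eq[OF l(1-3)] by (simp add: GH_group_def phi_0)
    qed
    have "\<one>\<^bsub>GH_group H\<^esub> \<in> U \<times> V"
      using U(2) \<open>\<phi> 0 \<in> V\<close> by (simp add: GH_group_def phi_0)
    then show "{\<one>\<^bsub>GH_group H\<^esub>} \<subseteq> (U \<times> V) \<inter> L_tilde \<eta> \<phi>"
      using GH.one_closed by simp
  qed
  moreover have "openin (prod_topology euclidean Y) (U \<times> V)"
    using U(1) V(1) by (simp add: openin_prod_Times_iff)
  ultimately show ?thesis by blast
qed

lemma Hausdorff_torus: "Hausdorff_space GH.Q"
proof -
  obtain O1 where O1: "openin (prod_topology euclidean Y) O1" "O1 \<inter> L_tilde \<eta> \<phi> = {\<one>\<^bsub>GH_group H\<^esub>}"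
    using L_tilde_discrete by blast
  have "Hausdorff_space (euclidean :: 'a topology)"
    unfolding Hausdorff_space_def disjnt_def by (metis hausdorff open_openin)
  then have "Hausdorff_space (prod_topology (euclidean :: 'a topology) Y)"
    using Hausdorff_Y by (simp add: Hausdorff_space_prod_topology)
  from GH.discrete_imp_closedin[OF this O1] show ?thesis by (rule GH.Hausdorff_quotient)
qed

lemma complete_torus: "group_complete (GH_group H Mod L_tilde \<eta> \<phi>) GH.Q"
proof -
  obtain O1 where O1: "openin (prod_topology euclidean Y) O1" "O1 \<inter> L_tilde \<eta> \<phi> = {\<one>\<^bsub>GH_group H\<^esub>}"
    using L_tilde_discrete by blast
  have "group_complete (GH_group H) (prod_topology (euclidean :: 'a topology) Y)"
    unfolding GH_group_def
    by (rule group_complete_DirProd[OF topological_abelian_additive_UNIV H.topological_abelian_axioms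
          group_complete_locally_compact[OF locally_compact] complete_Y])
  with O1 show ?thesis by (rule GH.complete_quotient)
qed

section \<open>The clauses of a completion for the induced map\<close>

lemma phi_bar_alpha: "t \<in> L \<Longrightarrow> phi_bar \<eta> H \<phi> (\<alpha> (x, t)) = \<pi> (x, \<phi> t)"
  by (rule phi_bar_coset[OF H.comm_group_axioms phi_hom])

lemma carrier_GL_quotient: "carrier (GL_group \<eta> Mod alpha_L \<eta>) = \<alpha> ` (UNIV \<times> L)"
  using GL.carrier_quot by (simp add: carrier_GL)

lemma phi_bar_image:
  "phi_bar \<eta> H \<phi> ` carrier (GL_group \<eta> Mod alpha_L \<eta>) = \<pi> ` (UNIV \<times> \<phi> ` L)"
proof -
  have "phi_bar \<eta> H \<phi> ` \<alpha> ` (UNIV \<times> L) = (\<lambda>(x, t). \<pi> (x, \<phi> t)) ` (UNIV \<times> L)"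
    unfolding image_image by (rule image_cong) (auto simp: phi_bar_alpha)
  also have "\<dots> = \<pi> ` (UNIV \<times> \<phi> ` L)" by force
  finally show ?thesis by (simp only: carrier_GL_quotient)
qed

lemma phi_bar_hom:
  "phi_bar \<eta> H \<phi> \<in> hom (GL_group \<eta> Mod alpha_L \<eta>) (GH_group H Mod L_tilde \<eta> \<phi>)"
proof (rule homI)
  fix c assume "c \<in> carrier (GL_group \<eta> Mod alpha_L \<eta>)"
  then obtain x s where "s \<in> L" "c = \<alpha> (x, s)" unfolding carrier_GL_quotient by auto
  then show "phi_bar \<eta> H \<phi> c \<in> carrier (GH_group H Mod L_tilde \<eta> \<phi>)"
    using phi_closed by (auto simp: phi_bar_alpha GH.carrier_quot carrier_GH)
next
  fix c d assume "c \<in> carrier (GL_group \<eta> Mod alpha_L \<eta>)" "d \<in> carrier (GL_group \<eta> Mod alpha_L \<eta>)"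
  then obtain x s y t where c: "s \<in> L" "c = \<alpha> (x, s)" and d: "t \<in> L" "d = \<alpha> (y, t)"
    unfolding carrier_GL_quotient by auto
  have "c \<otimes>\<^bsub>GL_group \<eta> Mod alpha_L \<eta>\<^esub> d = \<alpha> ((x, s) \<otimes>\<^bsub>GL_group \<eta>\<^esub> (y, t))"
    unfolding c d by (rule GL.proj.hom_mult[symmetric]) (simp_all add: carrier_GL c d)
  also have "(x, s) \<otimes>\<^bsub>GL_group \<eta>\<^esub> (y, t) = (x + y, s + t)" by (simp add: GL_group_def)
  finally have "phi_bar \<eta> H \<phi> (c \<otimes>\<^bsub>GL_group \<eta> Mod alpha_L \<eta>\<^esub> d) = \<pi> (x + y, \<phi> (s + t))"
    using c d by (simp only: phi_bar_alpha ac_L_closed)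
  also have "(x + y, \<phi> (s + t)) = (x, \<phi> s) \<otimes>\<^bsub>GH_group H\<^esub> (y, \<phi> t)"
    using c d by (simp add: GH_group_def phi_add)
  also have "\<pi> \<dots> = \<pi> (x, \<phi> s) \<otimes>\<^bsub>GH_group H Mod L_tilde \<eta> \<phi>\<^esub> \<pi> (y, \<phi> t)"
    by (rule GH.proj.hom_mult) (simp_all add: carrier_GH phi_closed c d)
  finally show "phi_bar \<eta> H \<phi> (c \<otimes>\<^bsub>GL_group \<eta> Mod alpha_L \<eta>\<^esub> d) =
      phi_bar \<eta> H \<phi> c \<otimes>\<^bsub>GH_group H Mod L_tilde \<eta> \<phi>\<^esub> phi_bar \<eta> H \<phi> d"
    using c d by (simp only: phi_bar_alpha)
qed

text \<open>By the universal property of the quotient, continuity is tested on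
  \<open>G \<times> L\<close>, where the map is the identity times \<open>\<phi>\<close> followed by
  the projection.\<close>

lemma continuous_phi_bar: "continuous_map GL.Q GH.Q (phi_bar \<eta> H \<phi>)"
proof (rule continuous_compose_quotient_map[OF GL.quotient_map_proj])
  have "continuous_map (GL_topology \<eta>) (prod_topology euclidean Y) (\<lambda>p. (fst p, \<phi> (snd p)))"
    unfolding GL_topology_def
    by (intro continuous_map_pairedI continuous_map_fst
        continuous_map_compose[OF continuous_map_snd continuous_phi, unfolded comp_def])
  from continuous_map_compose[OF this GH.continuous_proj]
  show "continuous_map (GL_topology \<eta>) GH.Q (phi_bar \<eta> H \<phi> \<circ> \<alpha>)"
    by (rule continuous_map_eq) (auto simp: GL_topology_def topspace_ac phi_bar_alpha)
qed

text \<open>Density of \<open>\<phi>(L)\<close> in \<open>H\<close> gives density of its product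
  with \<open>G\<close>, and the continuous surjection onto the torus preserves density.\<close>

lemma dense_phi_bar:
  "GH.Q closure_of (phi_bar \<eta> H \<phi> ` carrier (GL_group \<eta> Mod alpha_L \<eta>)) =
     carrier (GH_group H Mod L_tilde \<eta> \<phi>)"
proof (rule subset_antisym)
  show "GH.Q closure_of (phi_bar \<eta> H \<phi> ` carrier (GL_group \<eta> Mod alpha_L \<eta>)) \<subseteq>
      carrier (GH_group H Mod L_tilde \<eta> \<phi>)"
    using closure_of_subset_topspace[of GH.Q] by (simp only: GH.topspace_Q)
  have "carrier (GH_group H) = prod_topology euclidean Y closure_of ((UNIV :: 'a set) \<times> \<phi> ` L)"
    by (simp add: carrier_GH closure_of_Times dense_phi)
  then have "carrier (GH_group H Mod L_tilde \<eta> \<phi>) =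
      \<pi> ` (prod_topology euclidean Y closure_of (UNIV \<times> \<phi> ` L))"
    using GH.carrier_quot by simp
  also have "\<dots> \<subseteq> GH.Q closure_of (\<pi> ` (UNIV \<times> \<phi> ` L))"
    by (rule continuous_map_image_closure_subset[OF GH.continuous_proj])
  finally show "carrier (GH_group H Mod L_tilde \<eta> \<phi>) \<subseteq>
      GH.Q closure_of (phi_bar \<eta> H \<phi> ` carrier (GL_group \<eta> Mod alpha_L \<eta>))"
    by (simp only: phi_bar_image)
qed

lemma open_phi_bar:
  "open_map GL.Q (subtopology GH.Q (phi_bar \<eta> H \<phi> ` carrier (GL_group \<eta> Mod alpha_L \<eta>)))
     (phi_bar \<eta> H \<phi>)"
  unfolding open_map_def
proof (intro allI impI)
  fix W assume W: "openin GL.Q W"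
  let ?I = "phi_bar \<eta> H \<phi> ` carrier (GL_group \<eta> Mod alpha_L \<eta>)"
  have W_sub: "W \<subseteq> carrier (GL_group \<eta> Mod alpha_L \<eta>)"
    using openin_subset[OF W] by (simp only: GL.topspace_Q)
  define P where "P = {p \<in> UNIV \<times> L. \<alpha> p \<in> W}"
  have P: "openin (prod_topology euclidean (ac_topology \<eta>)) P"
    using openin_continuous_map_preimage[OF GL.continuous_proj W]
    by (simp add: P_def GL_topology_def topspace_ac)
  show "openin (subtopology GH.Q ?I) (phi_bar \<eta> H \<phi> ` W)"
  proof (subst openin_subopen, intro ballI)
    fix e assume "e \<in> phi_bar \<eta> H \<phi> ` W"
    then obtain c where c: "c \<in> W" "e = phi_bar \<eta> H \<phi> c" by blast
    then obtain x t where xt: "t \<in> L" "c = \<alpha> (x, t)"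
      using W_sub unfolding carrier_GL_quotient by auto
    then have "(x, t) \<in> P" using c by (simp add: P_def)
    then obtain U V where UV: "openin euclidean U" "openin (ac_topology \<eta>) V" "x \<in> U" "t \<in> V" "U \<times> V \<subseteq> P"
      by (rule openin_prod_topologyE[OF P])
    have "openin (subtopology Y (\<phi> ` L)) (\<phi> ` V)"
      using open_phi UV(2) by (simp add: open_map_def)
    then obtain V' where V': "openin Y V'" "\<phi> ` V = V' \<inter> \<phi> ` L"
      by (auto simp: openin_subtopology)
    have VL: "V \<subseteq> L" using openin_subset[OF UV(2)] by (simp only: topspace_ac)
    have "openin (prod_topology euclidean Y) (U \<times> V')"
      using UV(1) V'(1) by (simp add: openin_prod_Times_iff)
    then have "openin GH.Q (\<pi> ` (U \<times> V'))"
      using GH.open_map_proj by (simp add: open_map_def)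
    then have "openin (subtopology GH.Q ?I) (\<pi> ` (U \<times> V') \<inter> ?I)"
      by (auto simp: openin_subtopology)
    moreover have "e \<in> \<pi> ` (U \<times> V') \<inter> ?I"
    proof
      have "\<phi> t \<in> V'" using V'(2) UV(4) by blast
      then show "e \<in> \<pi> ` (U \<times> V')" using c xt UV(3) by (simp add: phi_bar_alpha)
      show "e \<in> ?I" using c W_sub by blast
    qed
    moreover have "\<pi> ` (U \<times> V') \<inter> ?I \<subseteq> phi_bar \<eta> H \<phi> ` W"
    proof
      fix d assume "d \<in> \<pi> ` (U \<times> V') \<inter> ?I"
      then obtain u v y s where d: "u \<in> U" "v \<in> V'" "d = \<pi> (u, v)" "s \<in> L" "d = \<pi> (y, \<phi> s)"
        unfolding phi_bar_image by blast
      have v: "v \<in> carrier H" using V'(1) d(2) by (rule H.openin_carrier)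
      \<comment> \<open>The two representatives of \<open>d\<close> lie in one coset, hence differ
        by some \<open>(l, \<phi> l)\<close>. This forces \<open>v\<close> into the image of
        \<open>\<phi>\<close>.\<close>
      have "(u, v) \<in> \<pi> (u, v)"
        using v by (force simp: L_tilde_coset phi_0 intro: exI[of _ 0] ac_L_closed)
      then have "(u, v) \<in> \<pi> (y, \<phi> s)" using d by simp
      then obtain l where l: "l \<in> L" "u = l + y" "v = \<phi> l \<otimes> \<phi> s"
        by (auto simp: L_tilde_coset)
      then have "v = \<phi> (l + s)" using d by (simp add: phi_add)
      then have "v \<in> V' \<inter> \<phi> ` L" using d l ac_L_closed(2) by blast
      \<comment> \<open>The preimage is chosen anew inside \<open>V\<close>, since
        \<open>l + s\<close> may differ from it by an element of the kernel of \<open>\<phi>\<close>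
        and lie outside \<open>V\<close>.\<close>
      then obtain v' where v': "v' \<in> V" "v = \<phi> v'" using V'(2) by blast
      then have "(u, v') \<in> P" using UV(5) d(1) by blast
      then have "\<alpha> (u, v') \<in> W" by (simp add: P_def)
      moreover have "d = phi_bar \<eta> H \<phi> (\<alpha> (u, v'))"
        using d(3) v' VL by (simp add: phi_bar_alpha subset_iff)
      ultimately show "d \<in> phi_bar \<eta> H \<phi> ` W" by blast
    qed
    ultimately show "\<exists>T. openin (subtopology GH.Q ?I) T \<and> e \<in> T \<and> T \<subseteq> phi_bar \<eta> H \<phi> ` W"
      by blast
  qed
qed

text \<open>The kernel is closed because the torus is Hausdorff, so it contains the closure of the
  neutral class. Conversely, each kernel class is represented by some \<open>(0, u)\<close> with
  \<open>u\<close> in the kernel of \<open>\<phi>\<close>, and a continuous map carries the closure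
  of 0 in \<open>L\<close> into that of the neutral class.\<close>

lemma kernel_phi_bar:
  "kernel (GL_group \<eta> Mod alpha_L \<eta>) (GH_group H Mod L_tilde \<eta> \<phi>) (phi_bar \<eta> H \<phi>) =
     GL.Q closure_of {\<one>\<^bsub>GL_group \<eta> Mod alpha_L \<eta>\<^esub>}" (is "?K = _")
proof (rule subset_antisym)
  have "closedin GL.Q {c \<in> topspace GL.Q. phi_bar \<eta> H \<phi> c \<in> {\<one>\<^bsub>GH_group H Mod L_tilde \<eta> \<phi>\<^esub>}}"
    by (rule closedin_continuous_map_preimage[OF continuous_phi_bar])
       (rule closedin_Hausdorff_singleton[OF Hausdorff_torus], unfold GH.topspace_Q,
        rule GH.quot.one_closed)
  also have "{c \<in> topspace GL.Q. phi_bar \<eta> H \<phi> c \<in> {\<one>\<^bsub>GH_group H Mod L_tilde \<eta> \<phi>\<^esub>}} = ?K"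
    unfolding kernel_def GL.topspace_Q by blast
  finally have "closedin GL.Q ?K" .
  moreover have "\<one>\<^bsub>GL_group \<eta> Mod alpha_L \<eta>\<^esub> \<in> ?K"
    unfolding kernel_def
    using hom_one[OF phi_bar_hom GL.quot.is_group GH.quot.is_group] GL.quot.one_closed by blast
  ultimately show "GL.Q closure_of {\<one>\<^bsub>GL_group \<eta> Mod alpha_L \<eta>\<^esub>} \<subseteq> ?K"
    by (intro closure_of_minimal) auto
  show "?K \<subseteq> GL.Q closure_of {\<one>\<^bsub>GL_group \<eta> Mod alpha_L \<eta>\<^esub>}"
  proof
    fix c assume c: "c \<in> ?K"
    then obtain x t where xt: "t \<in> L" "c = \<alpha> (x, t)"
      unfolding kernel_def carrier_GL_quotient by auto
    have "\<pi> (x, \<phi> t) = L_tilde \<eta> \<phi>" using c xt by (simp add: kernel_def phi_bar_alpha)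
    then have "(x, \<phi> t) \<in> L_tilde \<eta> \<phi>"
      by (subst (asm) GH.proj_eq_one_iff) (simp_all add: carrier_GH phi_closed xt)
    then have x: "x \<in> L" "\<phi> t = \<phi> x" by (auto simp: L_tilde_def)
    \<comment> \<open>Subtracting the diagonal element \<open>(x, x)\<close> moves the
      representative \<open>(x, t)\<close> to \<open>(0, u)\<close> within its class.\<close>
    define u where "u = t + - x"
    have u: "u \<in> L" unfolding u_def using xt x by (simp only: ac_L_closed)
    have "\<phi> u = \<one>"
      unfolding u_def using xt x by (simp only: phi_add phi_uminus ac_L_closed H.r_inv phi_closed)
    then have "u \<in> ac_topology \<eta> closure_of {0}"
      using u unfolding kernel_phi[symmetric] kernel_def by simp
    moreover have "continuous_map (ac_topology \<eta>) GL.Q (\<lambda>s. \<alpha> (0, s))"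
    proof -
      have "continuous_map (ac_topology \<eta>) (GL_topology \<eta>) (\<lambda>s. (0, s))"
        unfolding GL_topology_def by (intro continuous_map_pairedI) simp_all
      from continuous_map_compose[OF this GL.continuous_proj] show ?thesis by (simp add: comp_def)
    qed
    ultimately have "\<alpha> (0, u) \<in> GL.Q closure_of ((\<lambda>s. \<alpha> (0, s)) ` {0})"
      using continuous_map_image_closure_subset by blast
    moreover have "\<alpha> (0, 0) = \<one>\<^bsub>GL_group \<eta> Mod alpha_L \<eta>\<^esub>"
      using GL.proj.hom_one by (simp add: GL_group_def)
    moreover have "\<alpha> (0, u) = c"
    proof -
      have "(x, t) = (x, x) \<otimes>\<^bsub>GL_group \<eta>\<^esub> (0, u)" by (simp add: GL_group_def u_def)
      then have "c = \<alpha> (x, x) \<otimes>\<^bsub>GL_group \<eta> Mod alpha_L \<eta>\<^esub> \<alpha> (0, u)"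
        unfolding xt using GL.proj.hom_mult[of "(x, x)" "(0, u)"] x u by (simp add: carrier_GL)
      also have "\<alpha> (x, x) = \<one>\<^bsub>GL_group \<eta> Mod alpha_L \<eta>\<^esub>"
        unfolding one_FactGroup
        by (subst GL.proj_eq_one_iff) (simp_all add: carrier_GL x alpha_L_def)
      finally show ?thesis
        using GL.quot.l_one[of "\<alpha> (0, u)"] GL.proj.hom_closed[of "(0, u)"] u
        by (simp add: carrier_GL)
    qed
    ultimately show "c \<in> GL.Q closure_of {\<one>\<^bsub>GL_group \<eta> Mod alpha_L \<eta>\<^esub>}" by simp
  qed
qed

lemma defines_completion_phi_bar:
  "defines_completion (GL_quotient \<eta>) (GL_quotient_topology \<eta>)
     (torus_group \<eta> H \<phi>) (torus_topology \<eta> H Y \<phi>) (phi_bar \<eta> H \<phi>)"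
  unfolding defines_completion_def GL_quotient_def torus_group_def GL_topology_eq torus_topology_eq
    topological_abelian_iff[symmetric]
  using GL.quot.topological_abelian_axioms GH.quot.topological_abelian_axioms Hausdorff_torus
    complete_torus phi_bar_hom continuous_phi_bar dense_phi_bar open_phi_bar kernel_phi_bar
  by blast

lemma defines_completion_mixed:
  "defines_completion (additive_group UNIV) (mixed_topology \<eta>)
     (torus_group \<eta> H \<phi>) (torus_topology \<eta> H Y \<phi>) (\<lambda>x. phi_bar \<eta> H \<phi> (iota \<eta> x))"
  using defines_completion_pullback[OF iota_iso comm_group_additive_group_UNIV
      defines_completion_phi_bar]
  by (simp add: mixed_topology_def)

end

section \<open>From the standing assumptions to the completion\<close>

theorem proposition2:
  fixes \<theta> :: "'a::{topological_ab_group_add, t2_space} measure"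
    and A :: "nat \<Rightarrow> 'a set" and S :: "'a set"
    and w :: "'a \<Rightarrow> complex" and \<eta> :: "'a \<Rightarrow> complex"
    and H :: "('h, 'm) monoid_scheme" and Y :: "'h topology" and \<phi> :: "'a \<Rightarrow> 'h"
  assumes "locally_compact_space (euclidean :: 'a topology)"
    and "\<exists>K :: nat \<Rightarrow> 'a set. (\<forall>n. compact (K n)) \<and> (\<Union>n. K n) = UNIV"
    and "haar_measure \<theta>"
    and "\<And>n. open (A n)" and "\<And>n. compact (closure (A n))" and "A 0 \<noteq> {}"
    and "\<And>n. closure (A n) \<subseteq> A (Suc n)" and "(\<Union>n. A n) = UNIV"
    and "comb_measure S w" and "translation_bounded S w"
    and "\<And>z. z \<in> difference_set S \<Longrightarrow> (\<lambda>n. autocorr_approx \<theta> A S w n z) \<longlonglongrightarrow> \<eta> z"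
    and "\<And>z. z \<notin> difference_set S \<Longrightarrow> \<eta> z = 0"
    and "\<eta> 0 \<in> \<real>" and "Re (\<eta> 0) > 0"
    and "closed (difference_set S)" and "discrete (difference_set S)"
    and "\<And>\<epsilon>. \<epsilon> > 0 \<Longrightarrow> relatively_dense (ac_P \<eta> \<epsilon>)"
    and "defines_completion (additive_group (ac_L \<eta>)) (ac_topology \<eta>) H Y \<phi>"
  shows "defines_completion (GL_quotient \<eta>) (GL_quotient_topology \<eta>)
           (torus_group \<eta> H \<phi>) (torus_topology \<eta> H Y \<phi>) (phi_bar \<eta> H \<phi>)
       \<and> defines_completion (additive_group UNIV) (mixed_topology \<eta>)
           (torus_group \<eta> H \<phi>) (torus_topology \<eta> H Y \<phi>) (\<lambda>x. phi_bar \<eta> H \<phi> (iota \<eta> x))"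
proof -
  have eta_0: "\<eta> 0 \<noteq> 0" using assms(14) by auto
  interpret ac_completion \<eta> H Y \<phi>
  proof
    show "ac_dist \<eta> x z \<le> ac_dist \<eta> x y + ac_dist \<eta> y z" for x y z
      by (rule ac_dist_triangle[OF autocorr_inequality[OF assms(9,5,11,12)] eta_0])
    \<comment> \<open>A nonzero value of \<open>\<eta>\<close> occurs only on the difference set, so
      discreteness can be used at 0.\<close>
    have "0 \<in> difference_set S" using eta_0 assms(12) by blast
    then obtain T where T: "open T" "T \<inter> difference_set S = {0}"
      using assms(16) by (auto simp: discrete_def isolated_in_def)
    \<comment> \<open>The sign is absorbed by the symmetry of the difference set.\<close>
    have "z = 0" if "z \<in> T" "\<eta> (- z) \<noteq> 0" for z
    proof -
      have "- z \<in> difference_set S" using that assms(12) by blast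
      then obtain x y where "x \<in> S" "y \<in> S" "- z = x - y" by (auto simp: difference_set_def)
      moreover from this(3) have "z = y - x" by (metis minus_diff_eq minus_minus)
      ultimately have "z \<in> difference_set S" unfolding difference_set_def by blast
      then show ?thesis using T(2) that by blast
    qed
    then show "\<exists>U. open U \<and> 0 \<in> U \<and> (\<forall>z\<in>U. \<eta> (- z) \<noteq> 0 \<longrightarrow> z = 0)"
      using T by blast
  qed (use assms(1,18) eta_0 in auto)
  show ?thesis
    using defines_completion_phi_bar defines_completion_mixed by blast
qed

end
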